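(* Let $n\ge 1$. Then $(\widetilde{\mathcal J}(S^{2n}), ds^2,\tilde J)$ is a Kähler submanifold of $\mathcal J(\mathbb R^{2n+2})$.
   Context: For $m\ge1$, $\mathcal J(\mathbb R^{2m})=\{A\in GL(2m,\mathbb R) : A^2=-I\}$, a submanifold of $GL(2m,\mathbb R)$ with tangent space $T_A\mathcal J(\mathbb R^{2m})=\{X\in gl(2m,\mathbb R): AX=-XA\}$ at $A$. $\tilde J$ is the (almost) complex structure on $\mathcal J(\mathbb R^{2m})$ given by $\tilde J X=AX$ for $X\in T_A\mathcal J(\mathbb R^{2m})$. With $\langle X_1,X_2\rangle=\mathrm{tr}(X_1X_2^t)$, the metric $ds^2$ on $\mathcal J(\mathbb R^{2m})$ is $ds^2(X_1,X_2)=\frac12\langle X_1,X_2\rangle+\frac12\langle \tilde JX_1,\tilde JX_2\rangle$. Let $e_{-1}=(1,0,\dots,0)^t\in\mathbb R^{2n+2}$ and $S^{2n}=\{e_0\in\mathbb R^{2n+2}: |e_0|=1,\ e_0\perp e_{-1}\}$. The twistor space $\mathcal J(S^{2n})$ is the set of $A\in\mathcal J(\mathbb R^{2n+2})$ such that $e_0:=Ae_{-1}\in S^{2n}$ and $Av\perp e_{-1},e_0$ for every $v\perp e_{-1},e_0$; the projection $\pi:\mathcal J(S^{2n})\to S^{2n}$ is $\pi(A)=Ae_{-1}$, and $A$ restricted to $\{e_{-1},e_0\}^\perp=T_{e_0}S^{2n}$ is a complex structure on $T_{e_0}S^{2n}$. $\widetilde{\mathcal J}(S^{2n})\subset\mathcal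 J(S^{2n})$ is the subspace of those $A$ for which this complex structure on $T_{e_0}S^{2n}$ is orthogonal; one has $\widetilde{\mathcal J}(S^{2n})=\widetilde{\mathcal J}(\mathbb R^{2n+2})=\{A\in\mathcal J(\mathbb R^{2n+2}): A^t=-A\}$. On $\widetilde{\mathcal J}(S^{2n})$ the metric and complex structure are those induced from $\mathcal J(\mathbb R^{2n+2})$. A Kähler submanifold is a complex submanifold which is Kähler with the induced metric and complex structure. *)

theory Defs
  imports "HOL-Analysis.Analysis"
begin

section \<open>Smooth maps and diffeomorphisms of open subsets of Euclidean space\<close>

text \<open>All iterated directional derivatives up to order \<open>k\<close> exist and are continuous;
  intended for open \<open>U\<close> only.\<close>

primrec C_diff :: "nat \<Rightarrow> 'a::euclidean_space set \<Rightarrow> ('a \<Rightarrow> 'b::euclidean_space) \<Rightarrow> bool" where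
  "C_diff 0 U f \<longleftrightarrow> continuous_on U f"
| "C_diff (Suc k) U f \<longleftrightarrow>
     (\<forall>x\<in>U. f differentiable (at x)) \<and>
     (\<forall>v. C_diff k U (\<lambda>x. frechet_derivative f (at x) v))"

definition smooth :: "'a::euclidean_space set \<Rightarrow> ('a \<Rightarrow> 'b::euclidean_space) \<Rightarrow> bool" where
  "smooth U f \<longleftrightarrow> (\<forall>k. C_diff k U f)"

definition diffeo ::
  "'a::euclidean_space set \<Rightarrow> 'b::euclidean_space set \<Rightarrow> ('a \<Rightarrow> 'b) \<Rightarrow> ('b \<Rightarrow> 'a) \<Rightarrow> bool" where
  "diffeo U V \<Phi> \<Psi> \<longleftrightarrow>
     open U \<and> open V \<and> smooth U \<Phi> \<and> smooth V \<Psi> \<and> \<Phi> ` U = V \<and> \<Psi> ` V = U \<and>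
     (\<forall>x\<in>U. \<Psi> (\<Phi> x) = x) \<and> (\<forall>y\<in>V. \<Phi> (\<Psi> y) = y)"

text \<open>Smoothness on an arbitrary subset: local extendability to smooth maps on open sets.\<close>

definition smooth_map_on :: "'a::euclidean_space set \<Rightarrow> ('a \<Rightarrow> 'b::euclidean_space) \<Rightarrow> bool" where
  "smooth_map_on M f \<longleftrightarrow>
     (\<forall>p\<in>M. \<exists>U F. open U \<and> p \<in> U \<and> smooth U F \<and> (\<forall>q\<in>U \<inter> M. F q = f q))"


section \<open>Embedded submanifolds of Euclidean space\<close>

definition slice_chart ::
  "'a::euclidean_space set \<Rightarrow> 'a set \<Rightarrow> 'a set \<Rightarrow> ('a \<Rightarrow> 'a) \<Rightarrow> ('a \<Rightarrow> 'a) \<Rightarrow> 'a set \<Rightarrow> bool" where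
  "slice_chart M U V \<Phi> \<Psi> S \<longleftrightarrow> diffeo U V \<Phi> \<Psi> \<and> subspace S \<and> \<Phi> ` (U \<inter> M) = V \<inter> S"

definition tangent_space :: "'a::euclidean_space set \<Rightarrow> 'a \<Rightarrow> 'a set" where
  "tangent_space M p =
     {v. \<exists>\<gamma> \<epsilon>. \<epsilon> > 0 \<and> smooth {-\<epsilon><..<\<epsilon>::real} \<gamma> \<and> \<gamma> ` {-\<epsilon><..<\<epsilon>} \<subseteq> M \<and>
             \<gamma> 0 = p \<and> (\<gamma> has_vector_derivative v) (at 0)}"


section \<open>Complex manifolds and complex submanifolds\<close>

text \<open>A structure \<open>J\<close> assigns to each point \<open>p\<close> an endomorphism \<open>J p\<close> of the tangent space at
  \<open>p\<close>; its values off the tangent space are irrelevant.  A complex chart takes values in the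
  complex vector space \<open>S\<close> whose multiplication by \<open>\<i>\<close> is \<open>J0\<close>, and its differential
  intertwines \<open>J\<close> with \<open>J0\<close>.  As the differential maps the tangent space isomorphically onto
  \<open>S\<close>, it follows that \<open>J p\<close> preserves the tangent space and squares to \<open>-1\<close> there, that all
  transition maps are holomorphic, and that \<open>J\<close> is the structure given by this atlas.\<close>

definition complex_chart ::
  "'a::euclidean_space set \<Rightarrow> ('a \<Rightarrow> 'a \<Rightarrow> 'a) \<Rightarrow>
   'a set \<Rightarrow> 'a set \<Rightarrow> ('a \<Rightarrow> 'a) \<Rightarrow> ('a \<Rightarrow> 'a) \<Rightarrow> 'a set \<Rightarrow> ('a \<Rightarrow> 'a) \<Rightarrow> bool" where
  "complex_chart M J U V \<Phi> \<Psi> S J0 \<longleftrightarrow>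
     slice_chart M U V \<Phi> \<Psi> S \<and>
     linear J0 \<and> J0 ` S \<subseteq> S \<and> (\<forall>z\<in>S. J0 (J0 z) = - z) \<and>
     (\<forall>q\<in>U \<inter> M. \<forall>X\<in>tangent_space M q.
        frechet_derivative \<Phi> (at q) (J q X) = J0 (frechet_derivative \<Phi> (at q) X))"

definition complex_manifold :: "'a::euclidean_space set \<Rightarrow> ('a \<Rightarrow> 'a \<Rightarrow> 'a) \<Rightarrow> bool" where
  "complex_manifold M J \<longleftrightarrow>
     (\<exists>d. \<forall>p\<in>M. \<exists>U V \<Phi> \<Psi> S J0.
        p \<in> U \<and> complex_chart M J U V \<Phi> \<Psi> S J0 \<and> dim S = d)"

text \<open>\<open>M\<close> is locally cut out by a complex linear subspace in a complex chart of \<open>N\<close>.\<close>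

definition complex_submanifold ::
  "'a::euclidean_space set \<Rightarrow> 'a set \<Rightarrow> ('a \<Rightarrow> 'a \<Rightarrow> 'a) \<Rightarrow> bool" where
  "complex_submanifold M N J \<longleftrightarrow>
     complex_manifold N J \<and> M \<subseteq> N \<and>
     (\<exists>d. \<forall>p\<in>M. \<exists>U V \<Phi> \<Psi> S J0 S'.
        p \<in> U \<and> complex_chart N J U V \<Phi> \<Psi> S J0 \<and>
        subspace S' \<and> S' \<subseteq> S \<and> J0 ` S' \<subseteq> S' \<and> dim S' = d \<and> \<Phi> ` (U \<inter> M) = V \<inter> S')"


section \<open>Hermitian and Kaehler metrics\<close>

definition riemannian_metric ::
  "'a::euclidean_space set \<Rightarrow> ('a \<Rightarrow> 'a \<Rightarrow> 'a \<Rightarrow> real) \<Rightarrow> bool" where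
  "riemannian_metric M g \<longleftrightarrow>
     (\<forall>p\<in>M. \<forall>X\<in>tangent_space M p. \<forall>Y\<in>tangent_space M p. \<forall>Z\<in>tangent_space M p. \<forall>a b.
        g p (a *\<^sub>R X + b *\<^sub>R Y) Z = a * g p X Z + b * g p Y Z) \<and>
     (\<forall>p\<in>M. \<forall>X\<in>tangent_space M p. \<forall>Y\<in>tangent_space M p. g p X Y = g p Y X) \<and>
     (\<forall>p\<in>M. \<forall>X\<in>tangent_space M p. X \<noteq> 0 \<longrightarrow> g p X X > 0) \<and>
     (\<forall>X Y. smooth_map_on M X \<and> smooth_map_on M Y \<and>
        (\<forall>p\<in>M. X p \<in> tangent_space M p \<and> Y p \<in> tangent_space M p) \<longrightarrow>
        smooth_map_on M (\<lambda>p. g p (X p) (Y p)))"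

definition hermitian_metric ::
  "'a::euclidean_space set \<Rightarrow> ('a \<Rightarrow> 'a \<Rightarrow> 'a) \<Rightarrow> ('a \<Rightarrow> 'a \<Rightarrow> 'a \<Rightarrow> real) \<Rightarrow> bool" where
  "hermitian_metric M J g \<longleftrightarrow>
     riemannian_metric M g \<and>
     (\<forall>p\<in>M. \<forall>X\<in>tangent_space M p. \<forall>Y\<in>tangent_space M p. g p (J p X) (J p Y) = g p X Y)"

definition fundamental_form ::
  "('a \<Rightarrow> 'a \<Rightarrow> 'a) \<Rightarrow> ('a \<Rightarrow> 'a \<Rightarrow> 'a \<Rightarrow> real) \<Rightarrow> 'a \<Rightarrow> 'a \<Rightarrow> 'a \<Rightarrow> real" where
  "fundamental_form J g p X Y = g p (J p X) Y"

definition pullback2 ::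
  "('a::euclidean_space \<Rightarrow> 'a) \<Rightarrow> ('a \<Rightarrow> 'a \<Rightarrow> 'a \<Rightarrow> real) \<Rightarrow> 'a \<Rightarrow> 'a \<Rightarrow> 'a \<Rightarrow> real" where
  "pullback2 \<Psi> \<omega> y v w =
     \<omega> (\<Psi> y) (frechet_derivative \<Psi> (at y) v) (frechet_derivative \<Psi> (at y) w)"

definition ext_deriv2 ::
  "('a::euclidean_space \<Rightarrow> 'a \<Rightarrow> 'a \<Rightarrow> real) \<Rightarrow> 'a \<Rightarrow> 'a \<Rightarrow> 'a \<Rightarrow> 'a \<Rightarrow> real" where
  "ext_deriv2 \<eta> y u v w =
     deriv (\<lambda>t. \<eta> (y + t *\<^sub>R u) v w) 0 - deriv (\<lambda>t. \<eta> (y + t *\<^sub>R v) u w) 0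
     + deriv (\<lambda>t. \<eta> (y + t *\<^sub>R w) u v) 0"

text \<open>A smooth 2-form on \<open>M\<close> is closed if its exterior derivative, computed in the coordinates
  \<open>y \<in> V \<inter> S\<close> of any slice chart with constant coefficient fields \<open>u, v, w \<in> S\<close>, vanishes.\<close>

definition closed_2form ::
  "'a::euclidean_space set \<Rightarrow> ('a \<Rightarrow> 'a \<Rightarrow> 'a \<Rightarrow> real) \<Rightarrow> bool" where
  "closed_2form M \<omega> \<longleftrightarrow>
     (\<forall>U V \<Phi> \<Psi> S. slice_chart M U V \<Phi> \<Psi> S \<longrightarrow>
        (\<forall>y\<in>V \<inter> S. \<forall>u\<in>S. \<forall>v\<in>S. \<forall>w\<in>S. ext_deriv2 (pullback2 \<Psi> \<omega>) y u v w = 0))"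

definition kaehler_manifold ::
  "'a::euclidean_space set \<Rightarrow> ('a \<Rightarrow> 'a \<Rightarrow> 'a \<Rightarrow> real) \<Rightarrow> ('a \<Rightarrow> 'a \<Rightarrow> 'a) \<Rightarrow> bool" where
  "kaehler_manifold M g J \<longleftrightarrow>
     complex_manifold M J \<and> hermitian_metric M J g \<and> closed_2form M (fundamental_form J g)"

text \<open>The metric and complex structure induced on \<open>M\<close> are the restrictions of \<open>g\<close> and \<open>J\<close>, so
  the same \<open>g\<close> and \<open>J\<close> appear for \<open>M\<close> and for \<open>N\<close>.\<close>

definition kaehler_submanifold ::
  "'a::euclidean_space set \<Rightarrow> 'a set \<Rightarrow> ('a \<Rightarrow> 'a \<Rightarrow> 'a \<Rightarrow> real) \<Rightarrow> ('a \<Rightarrow> 'a \<Rightarrow> 'a) \<Rightarrow> bool" where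
  "kaehler_submanifold M N g J \<longleftrightarrow> complex_submanifold M N J \<and> kaehler_manifold M g J"


section \<open>Complex structures on Euclidean space and twistor spaces of spheres\<close>

definition complex_structures :: "(real^'i^'i) set" where
  "complex_structures = {A. invertible A \<and> A ** A = - mat 1}"

definition J_tilde :: "real^'i^'i \<Rightarrow> real^'i^'i \<Rightarrow> real^'i^'i" where
  "J_tilde A X = A ** X"

definition trace_inner :: "real^'i^'i \<Rightarrow> real^'i^'i \<Rightarrow> real" where
  "trace_inner X Y = trace (X ** transpose Y)"

definition ds2 :: "real^'i^'i \<Rightarrow> real^'i^'i \<Rightarrow> real^'i^'i \<Rightarrow> real" where
  "ds2 A X Y = 1/2 * trace_inner X Y + 1/2 * trace_inner (J_tilde A X) (J_tilde A Y)"

text \<open>Coordinates of the ambient space of the sphere are indexed by a finite type, with a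
  distinguished index \<open>i0\<close> in the role of the first coordinate, so that \<open>e\<^sub>-\<^sub>1 = axis i0 1\<close>.
  When the index type has \<open>2n + 2\<close> elements, \<open>sphere_perp i0\<close> is the \<open>2n\<close>-sphere.\<close>

abbreviation e_minus1 :: "'i::finite \<Rightarrow> real^'i" where
  "e_minus1 i0 \<equiv> axis i0 1"

definition sphere_perp :: "'i::finite \<Rightarrow> (real^'i) set" where
  "sphere_perp i0 = {v. norm v = 1 \<and> v \<bullet> e_minus1 i0 = 0}"

definition twistor_proj :: "'i::finite \<Rightarrow> real^'i^'i \<Rightarrow> real^'i" where
  "twistor_proj i0 A = A *v e_minus1 i0"

text \<open>The orthogonal complement of \<open>e\<^sub>-\<^sub>1\<close> and \<open>e\<close>, i.e. the tangent space of the sphere at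
  \<open>e\<close>.\<close>

definition sphere_tangent :: "'i::finite \<Rightarrow> real^'i \<Rightarrow> (real^'i) set" where
  "sphere_tangent i0 e = {v. v \<bullet> e_minus1 i0 = 0 \<and> v \<bullet> e = 0}"

definition twistor_space :: "'i::finite \<Rightarrow> (real^'i^'i) set" where
  "twistor_space i0 =
     {A \<in> complex_structures. twistor_proj i0 A \<in> sphere_perp i0 \<and>
        (\<forall>v\<in>sphere_tangent i0 (twistor_proj i0 A). A *v v \<in> sphere_tangent i0 (twistor_proj i0 A))}"

definition orth_twistor_space :: "'i::finite \<Rightarrow> (real^'i^'i) set" where
  "orth_twistor_space i0 =
     {A \<in> twistor_space i0.
        \<forall>v\<in>sphere_tangent i0 (twistor_proj i0 A). \<forall>w\<in>sphere_tangent i0 (twistor_proj i0 A).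
          (A *v v) \<bullet> (A *v w) = v \<bullet> w}"

end

theory Submission
  imports Defs
begin

text \<open>
  Each complex structure \<open>A\<^sub>0\<close> is the centre of the chart
  \<open>A \<mapsto> W = (A + A\<^sub>0)\<^sup>-\<^sup>1 (A\<^sub>0 - A)\<close>.  It maps \<open>A\<^sup>2 = -1\<close> to the linear equation
  \<open>W A\<^sub>0 = - A\<^sub>0 W\<close>, turns \<open>X \<mapsto> A X\<close> into the constant structure \<open>W \<mapsto> A\<^sub>0 W\<close>, and, for skew
  \<open>A\<^sub>0\<close>, maps skew matrices to skew matrices; the orthogonal twistor space consists precisely of the
  skew complex structures.  There the fundamental form is \<open>\<omega>(X, Y) = \<langle>A X, Y\<rangle>\<close>.  In the
  exterior derivative the second derivatives of a parametrization cancel by symmetry and skewness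
  of \<open>A\<close>, leaving traces of products of three matrices that anticommute with \<open>A\<close>, which vanish.
\<close>

section \<open>Calculus of smooth maps\<close>

text \<open>On an open set the derivative at a point depends only on the values nearby, so agreement
  on \<open>U\<close> passes to the directional derivatives and the induction closes.\<close>

lemma C_diff_cong:
  assumes "open U" and "\<And>x. x \<in> U \<Longrightarrow> f x = g x" and "C_diff k U f"
  shows "C_diff k U g"
  using assms(2,3)
proof (induction k arbitrary: f g)
  case 0
  then show ?case by (simp cong: continuous_on_cong)
next
  case (Suc k)
  have fd: "(g has_derivative frechet_derivative f (at x)) (at x)" if "x \<in> U" for x
    using Suc.prems that assms(1)
    by (auto simp: frechet_derivative_works intro: has_derivative_transform_within_open)
  have "C_diff k U (\<lambda>x. frechet_derivative g (at x) v)" for v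
    by (rule Suc.IH[of "\<lambda>x. frechet_derivative f (at x) v"])
       (use Suc.prems fd frechet_derivative_at in \<open>force+\<close>)
  then show ?case using fd by (auto simp: differentiable_def)
qed

text \<open>Replaces the choice operator \<open>frechet_derivative\<close> by an explicit derivative
  \<open>f'\<close>; the inductive closure proofs below go through this rule.\<close>

lemma C_diff_SucI:
  assumes "open U" and "\<And>x. x \<in> U \<Longrightarrow> (f has_derivative f' x) (at x)"
    and "\<And>v. C_diff k U (\<lambda>x. f' x v)"
  shows "C_diff (Suc k) U f"
proof -
  have "C_diff k U (\<lambda>x. frechet_derivative f (at x) v)" for v
    by (rule C_diff_cong[OF assms(1) _ assms(3)[of v]]) (metis assms(2) frechet_derivative_at)
  then show ?thesis using assms(2) by (auto simp: differentiable_def)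
qed

lemma C_diff_SucD:
  assumes "C_diff (Suc k) U f"
  shows "C_diff k U f"
  using assms
proof (induction k arbitrary: f)
  case 0
  then show ?case
    by (auto intro!: continuous_at_imp_continuous_on differentiable_imp_continuous_within)
next
  case (Suc k)
  then show ?case by (metis C_diff.simps(2))
qed

lemma C_diff_subset:
  assumes "C_diff k U f" "V \<subseteq> U"
  shows "C_diff k V f"
  using assms by (induction k arbitrary: f) (auto intro: continuous_on_subset)

lemma C_diff_const: "C_diff k U (\<lambda>x. c)"
  by (induction k arbitrary: c) auto

lemma C_diff_ident: "C_diff k U (\<lambda>x. x)"
  by (cases k) (auto simp: C_diff_const continuous_on_id)

lemma C_diff_bounded_linear:
  assumes "bounded_linear L" "open U" "C_diff k U f"
  shows "C_diff k U (\<lambda>x. L (f x))"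
  using assms(3)
proof (induction k arbitrary: f)
  case 0
  then show ?case using assms(1) by (simp add: bounded_linear.continuous_on)
next
  case (Suc k)
  show ?case
    by (rule C_diff_SucI[OF assms(2), where f' = "\<lambda>x v. L (frechet_derivative f (at x) v)"])
       (use Suc in \<open>auto simp: frechet_derivative_works intro: bounded_linear.has_derivative[OF assms(1)]\<close>)
qed

lemma C_diff_add:
  assumes "open U" "C_diff k U f" "C_diff k U g"
  shows "C_diff k U (\<lambda>x. f x + g x)"
  using assms(2,3)
proof (induction k arbitrary: f g)
  case 0
  then show ?case by (simp add: continuous_on_add)
next
  case (Suc k)
  show ?case
    by (rule C_diff_SucI[OF assms(1), where
          f' = "\<lambda>x v. frechet_derivative f (at x) v + frechet_derivative g (at x) v"])
       (use Suc in \<open>auto simp: frechet_derivative_works intro: has_derivative_add\<close>)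
qed

text \<open>The product rule leaves one factor undifferentiated in each summand.
  \<open>C_diff_SucD\<close> lowers the order of that factor to \<open>k\<close>, which is what the
  induction hypothesis asks for.\<close>

lemma C_diff_bounded_bilinear:
  assumes "bounded_bilinear B" "open U" "C_diff k U f" "C_diff k U g"
  shows "C_diff k U (\<lambda>x. B (f x) (g x))"
  using assms(3,4)
proof (induction k arbitrary: f g)
  case 0
  then show ?case using bounded_bilinear.continuous_on[OF assms(1)] by simp
next
  case (Suc k)
  have "C_diff k U f" "C_diff k U g" using Suc.prems C_diff_SucD by blast+
  then have C: "C_diff k U (\<lambda>x. B (f x) (frechet_derivative g (at x) v)
               + B (frechet_derivative f (at x) v) (g x))" for v
    using Suc by (intro C_diff_add[OF assms(2)] Suc.IH) auto
  have D: "((\<lambda>x. B (f x) (g x)) has_derivative (\<lambda>v. B (f x) (frechet_derivative g (at x) v)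
               + B (frechet_derivative f (at x) v) (g x))) (at x)" if "x \<in> U" for x
    using Suc.prems that
    by (intro bounded_bilinear.FDERIV[OF assms(1)]) (auto simp flip: frechet_derivative_works)
  show ?case by (rule C_diff_SucI[OF assms(2) D C])
qed

section \<open>Symmetry of second derivatives\<close>

lemma has_vector_derivative_along_line:
  assumes "(f has_derivative f') (at (x + s *\<^sub>R u))"
  shows "((\<lambda>s. f (x + s *\<^sub>R u)) has_vector_derivative f' u) (at s)"
proof -
  have "((\<lambda>s. x + s *\<^sub>R u) has_derivative (\<lambda>k. k *\<^sub>R u)) (at s)"
    by (auto intro!: derivative_eq_intros)
  from has_derivative_compose[OF this assms] show ?thesis
    using linear_cmul[OF has_derivative_linear[OF assms]]
    by (simp add: has_vector_derivative_def)
qed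

lemma has_real_derivative_along_line:
  assumes "(f has_derivative f') (at (x + s *\<^sub>R u))"
  shows "((\<lambda>s. f (x + s *\<^sub>R u)) has_real_derivative f' u) (at s)"
  unfolding has_real_derivative_iff_has_vector_derivative
  by (rule has_vector_derivative_along_line[OF assms])

text \<open>The mean value theorem is applied twice, first in direction \<open>u\<close> and then in
  direction \<open>v\<close>. This turns the second difference into \<open>f''\<close> at an
  intermediate point times the square of \<open>h\<close>; continuity moves that point to
  \<open>y\<close> at cost \<open>e\<close>.\<close>

lemma second_difference_estimate:
  fixes f :: "'a::real_normed_vector \<Rightarrow> real"
  assumes V: "open V" "y \<in> V"
    and f': "\<And>x. x \<in> V \<Longrightarrow> (f has_derivative f' x) (at x)"
    and f'': "\<And>x. x \<in> V \<Longrightarrow> ((\<lambda>x. f' x u) has_derivative f'' x) (at x)"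
    and cont: "continuous_on V (\<lambda>x. f'' x v)"
    and e: "e > 0"
  shows "\<exists>d>0. \<forall>h. 0 < h \<and> h < d \<longrightarrow>
    \<bar>f (y + h *\<^sub>R u + h *\<^sub>R v) - f (y + h *\<^sub>R u) - f (y + h *\<^sub>R v) + f y - h\<^sup>2 * f'' y v\<bar> \<le> e * h\<^sup>2"
proof -
  obtain r1 where r1: "r1 > 0" "ball y r1 \<subseteq> V" using V openE by blast
  obtain r2 where r2: "r2 > 0" "\<And>z. z \<in> V \<Longrightarrow> dist z y < r2 \<Longrightarrow> dist (f'' z v) (f'' y v) < e"
    using cont V(2) e unfolding continuous_on_iff by meson
  define r where "r = min r1 r2"
  have r: "r > 0" using r1 r2 by (simp add: r_def)
  \<comment> \<open>The summand 1 keeps \<open>K\<close> positive even when \<open>u\<close> and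
    \<open>v\<close> vanish. With \<open>d = r / K\<close> the whole parallelogram of side
    parameters up to \<open>h\<close> stays within distance \<open>r\<close> of
    \<open>y\<close>.\<close>
  define K where "K = norm u + norm v + 1"
  have K: "K > 0" unfolding K_def by (smt (verit) norm_ge_zero)
  define d where "d = r / K"
  have near: "y + s *\<^sub>R u + t *\<^sub>R v \<in> V \<and> dist (y + s *\<^sub>R u + t *\<^sub>R v) y < r"
    if "0 \<le> s" "s \<le> h" "0 \<le> t" "t \<le> h" "0 < h" "h < d" for s t h
  proof -
    have "norm (s *\<^sub>R u + t *\<^sub>R v) \<le> s * norm u + t * norm v"
      using that by (metis abs_of_nonneg norm_scaleR norm_triangle_ineq)
    also have "\<dots> \<le> h * norm u + h * norm v"
      using that by (intro add_mono mult_right_mono) auto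
    also have "\<dots> \<le> h * K" using that by (simp add: K_def algebra_simps)
    also have "\<dots> < r" using that K by (simp add: d_def field_simps)
    finally have "dist (y + s *\<^sub>R u + t *\<^sub>R v) y < r" by (simp add: dist_norm add.assoc)
    then show ?thesis using r1(2) by (auto simp: r_def mem_ball dist_commute)
  qed
  have "\<bar>f (y + h *\<^sub>R u + h *\<^sub>R v) - f (y + h *\<^sub>R u) - f (y + h *\<^sub>R v) + f y - h\<^sup>2 * f'' y v\<bar> \<le> e * h\<^sup>2"
    if h: "0 < h" "h < d" for h
  proof -
    \<comment> \<open>First mean value step, for the difference of \<open>f\<close> along two
      parallel segments in direction \<open>u\<close>. The terms with factor 0 keep both segments
      instances of one derivative formula.\<close>
    have "\<exists>z>0. z < h \<and> (f (y + h *\<^sub>R u + h *\<^sub>R v) - f (y + h *\<^sub>R u + 0 *\<^sub>R v))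
        - (f (y + 0 *\<^sub>R u + h *\<^sub>R v) - f (y + 0 *\<^sub>R u + 0 *\<^sub>R v))
        = (h - 0) * (f' (y + z *\<^sub>R u + h *\<^sub>R v) u - f' (y + z *\<^sub>R u + 0 *\<^sub>R v) u)"
    proof (rule MVT2[OF h(1)])
      fix s assume s: "0 \<le> s" "s \<le> h"
      have d: "((\<lambda>s. f (y + s *\<^sub>R u + t *\<^sub>R v)) has_real_derivative f' (y + s *\<^sub>R u + t *\<^sub>R v) u) (at s)"
        if t: "0 \<le> t" "t \<le> h" for t
      proof -
        have m: "y + s *\<^sub>R u + t *\<^sub>R v \<in> V" using near s t h by blast
        show ?thesis
          using has_real_derivative_along_line[of f "f' (y + s *\<^sub>R u + t *\<^sub>R v)" "y + t *\<^sub>R v" s u] f'[OF m]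
          by (simp add: add_ac)
      qed
      show "((\<lambda>s. f (y + s *\<^sub>R u + h *\<^sub>R v) - f (y + s *\<^sub>R u + 0 *\<^sub>R v)) has_real_derivative
          f' (y + s *\<^sub>R u + h *\<^sub>R v) u - f' (y + s *\<^sub>R u + 0 *\<^sub>R v) u) (at s)"
        using d[of h] d[of 0] h by (intro DERIV_diff) auto
    qed
    then obtain z where z: "0 < z" "z < h" and
      zeq: "f (y + h *\<^sub>R u + h *\<^sub>R v) - f (y + h *\<^sub>R u) - f (y + h *\<^sub>R v) + f y
        = h * (f' (y + z *\<^sub>R u + h *\<^sub>R v) u - f' (y + z *\<^sub>R u + 0 *\<^sub>R v) u)"
      by (auto simp: algebra_simps)
    have "\<exists>w>0. w < h \<and> f' (y + z *\<^sub>R u + h *\<^sub>R v) u - f' (y + z *\<^sub>R u + 0 *\<^sub>R v) u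
        = (h - 0) * f'' (y + z *\<^sub>R u + w *\<^sub>R v) v"
    proof (rule MVT2[OF h(1)])
      fix t assume t: "0 \<le> t" "t \<le> h"
      have m: "y + z *\<^sub>R u + t *\<^sub>R v \<in> V" using near z t h by (meson less_imp_le)
      show "((\<lambda>t. f' (y + z *\<^sub>R u + t *\<^sub>R v) u) has_real_derivative
            f'' (y + z *\<^sub>R u + t *\<^sub>R v) v) (at t)"
        by (rule has_real_derivative_along_line[OF f''[OF m]])
    qed
    then obtain w where w: "0 < w" "w < h" and
      weq: "f' (y + z *\<^sub>R u + h *\<^sub>R v) u - f' (y + z *\<^sub>R u + 0 *\<^sub>R v) u
        = h * f'' (y + z *\<^sub>R u + w *\<^sub>R v) v" by auto
    have "\<bar>f'' (y + z *\<^sub>R u + w *\<^sub>R v) v - f'' y v\<bar> \<le> e"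
      using r2(2)[of "y + z *\<^sub>R u + w *\<^sub>R v"] near[of z h w] z w h
      by (auto simp: dist_real_def r_def)
    then have "h\<^sup>2 * \<bar>f'' (y + z *\<^sub>R u + w *\<^sub>R v) v - f'' y v\<bar> \<le> h\<^sup>2 * e"
      by (intro mult_left_mono) auto
    moreover have "h * (h * f'' (y + z *\<^sub>R u + w *\<^sub>R v) v) - h\<^sup>2 * f'' y v
        = h\<^sup>2 * (f'' (y + z *\<^sub>R u + w *\<^sub>R v) v - f'' y v)"
      by (simp add: power2_eq_square algebra_simps)
    ultimately show ?thesis
      unfolding zeq weq by (simp add: abs_mult mult.commute)
  qed
  moreover have "d > 0" using r K by (simp add: d_def)
  ultimately show ?thesis by blast
qed

text \<open>The second difference is symmetric in \<open>u\<close> and \<open>v\<close>, so both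
  mixed derivatives approximate the same quantity.\<close>

lemma second_derivative_symmetric_real:
  fixes f :: "'a::real_normed_vector \<Rightarrow> real"
  assumes V: "open V" "y \<in> V"
    and f': "\<And>x. x \<in> V \<Longrightarrow> (f has_derivative f' x) (at x)"
    and f'': "\<And>x v. x \<in> V \<Longrightarrow> ((\<lambda>x. f' x v) has_derivative f'' v x) (at x)"
    and cont: "\<And>u v. continuous_on V (\<lambda>x. f'' u x v)"
  shows "f'' u y v = f'' v y u"
proof (rule ccontr)
  assume ne: "f'' u y v \<noteq> f'' v y u"
  \<comment> \<open>A third of the supposed gap: the two estimates together allow a gap of at most
    \<open>2 * e\<close>.\<close>
  define e where "e = \<bar>f'' u y v - f'' v y u\<bar> / 3"
  have e: "e > 0" using ne by (simp add: e_def)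
  obtain d1 where d1: "d1 > 0" "\<And>h. 0 < h \<Longrightarrow> h < d1 \<Longrightarrow>
    \<bar>f (y + h *\<^sub>R u + h *\<^sub>R v) - f (y + h *\<^sub>R u) - f (y + h *\<^sub>R v) + f y - h\<^sup>2 * f'' u y v\<bar> \<le> e * h\<^sup>2"
    using second_difference_estimate[OF V f' f'' cont e, of u v] by blast
  obtain d2 where d2: "d2 > 0" "\<And>h. 0 < h \<Longrightarrow> h < d2 \<Longrightarrow>
    \<bar>f (y + h *\<^sub>R v + h *\<^sub>R u) - f (y + h *\<^sub>R v) - f (y + h *\<^sub>R u) + f y - h\<^sup>2 * f'' v y u\<bar> \<le> e * h\<^sup>2"
    using second_difference_estimate[OF V f' f'' cont e, of v u] by blast
  define h where "h = min d1 d2 / 2"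
  have h: "0 < h" "h < d1" "h < d2" using d1(1) d2(1) by (auto simp: h_def min_def)
  have c: "y + h *\<^sub>R v + h *\<^sub>R u = y + h *\<^sub>R u + h *\<^sub>R v" by (simp add: algebra_simps)
  have "\<bar>h\<^sup>2 * f'' u y v - h\<^sup>2 * f'' v y u\<bar> \<le> 2 * (e * h\<^sup>2)"
    using d1(2)[OF h(1,2)] d2(2)[OF h(1,3)] unfolding c by linarith
  then have "h\<^sup>2 * \<bar>f'' u y v - f'' v y u\<bar> \<le> h\<^sup>2 * (2 * e)"
    unfolding right_diff_distrib[symmetric] abs_mult by (simp add: mult_ac)
  then have "\<bar>f'' u y v - f'' v y u\<bar> \<le> 2 * e"
    using h(1) by simp
  then show False using e by (simp add: e_def)
qed

lemma second_derivative_symmetric: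
  fixes f :: "'a::euclidean_space \<Rightarrow> 'b::euclidean_space"
  assumes "open V" "y \<in> V" "smooth V f"
  shows "frechet_derivative (\<lambda>x. frechet_derivative f (at x) u) (at y) v
       = frechet_derivative (\<lambda>x. frechet_derivative f (at x) v) (at y) u"
proof (rule euclidean_eqI)
  fix b :: 'b assume "b \<in> Basis"
  have C: "C_diff (Suc (Suc 0)) V f" using assms(3) by (simp only: smooth_def)
  show "frechet_derivative (\<lambda>x. frechet_derivative f (at x) u) (at y) v \<bullet> b
       = frechet_derivative (\<lambda>x. frechet_derivative f (at x) v) (at y) u \<bullet> b"
  proof (rule second_derivative_symmetric_real[OF assms(1,2), where
        f = "\<lambda>x. f x \<bullet> b" and f' = "\<lambda>x u. frechet_derivative f (at x) u \<bullet> b" and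
        f'' = "\<lambda>u x v. frechet_derivative (\<lambda>x. frechet_derivative f (at x) u) (at x) v \<bullet> b"])
    show "continuous_on V (\<lambda>x. frechet_derivative (\<lambda>x. frechet_derivative f (at x) u) (at x) v \<bullet> b)"
      for u v using C by (auto intro!: continuous_intros)
  qed (use C in \<open>auto simp: frechet_derivative_works intro: has_derivative_inner_left\<close>)
qed

section \<open>Smooth maps on arbitrary subsets, by combining local extensions on intersections of
  neighbourhoods\<close>

lemma smooth_map_on_bounded_bilinear:
  assumes "bounded_bilinear B" "smooth_map_on M f" "smooth_map_on M g"
  shows "smooth_map_on M (\<lambda>p. B (f p) (g p))"
  unfolding smooth_map_on_def
proof
  fix p assume p: "p \<in> M"
  obtain U F where F: "open U" "p \<in> U" "smooth U F" "\<And>q. q \<in> U \<inter> M \<Longrightarrow> F q = f q"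
    using assms(2) p unfolding smooth_map_on_def by meson
  obtain V G where G: "open V" "p \<in> V" "smooth V G" "\<And>q. q \<in> V \<inter> M \<Longrightarrow> G q = g q"
    using assms(3) p unfolding smooth_map_on_def by meson
  have "smooth (U \<inter> V) (\<lambda>q. B (F q) (G q))"
    unfolding smooth_def
  proof
    fix k
    have "C_diff k (U \<inter> V) F" "C_diff k (U \<inter> V) G"
      using F(3) G(3) by (auto simp: smooth_def intro: C_diff_subset)
    then show "C_diff k (U \<inter> V) (\<lambda>q. B (F q) (G q))"
      using F(1) G(1) by (intro C_diff_bounded_bilinear[OF assms(1)] open_Int)
  qed
  then show "\<exists>W H. open W \<and> p \<in> W \<and> smooth W H \<and> (\<forall>q\<in>W \<inter> M. H q = B (f q) (g q))"
    using F G by (intro exI[of _ "U \<inter> V"] exI[of _ "\<lambda>q. B (F q) (G q)"]) auto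
qed

lemma smooth_map_on_add:
  assumes "smooth_map_on M f" "smooth_map_on M g"
  shows "smooth_map_on M (\<lambda>p. f p + g p)"
  unfolding smooth_map_on_def
proof
  fix p assume p: "p \<in> M"
  obtain U F where F: "open U" "p \<in> U" "smooth U F" "\<And>q. q \<in> U \<inter> M \<Longrightarrow> F q = f q"
    using assms(1) p unfolding smooth_map_on_def by meson
  obtain V G where G: "open V" "p \<in> V" "smooth V G" "\<And>q. q \<in> V \<inter> M \<Longrightarrow> G q = g q"
    using assms(2) p unfolding smooth_map_on_def by meson
  have "smooth (U \<inter> V) (\<lambda>q. F q + G q)"
    unfolding smooth_def
  proof
    fix k
    have "C_diff k (U \<inter> V) F" "C_diff k (U \<inter> V) G"
      using F(3) G(3) by (auto simp: smooth_def intro: C_diff_subset)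
    then show "C_diff k (U \<inter> V) (\<lambda>q. F q + G q)"
      using F(1) G(1) by (intro C_diff_add open_Int)
  qed
  then show "\<exists>W H. open W \<and> p \<in> W \<and> smooth W H \<and> (\<forall>q\<in>W \<inter> M. H q = f q + g q)"
    using F G by (intro exI[of _ "U \<inter> V"] exI[of _ "\<lambda>q. F q + G q"]) auto
qed

lemma smooth_map_on_ident: "smooth_map_on M (\<lambda>p. p)"
  unfolding smooth_map_on_def
  by (intro ballI exI[of _ UNIV] exI[of _ "\<lambda>p. p"]) (simp add: smooth_def C_diff_ident)

lemma smooth_map_on_const: "smooth_map_on M (\<lambda>p. c)"
  unfolding smooth_map_on_def
  by (intro ballI exI[of _ UNIV] exI[of _ "\<lambda>p. c"]) (simp add: smooth_def C_diff_const)

section \<open>Matrix algebra and matrix inversion\<close>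

lemma bounded_bilinear_matrix_mult:
  "bounded_bilinear ((**) :: real^'n^'m \<Rightarrow> real^'p^'n \<Rightarrow> real^'p^'m)"
  unfolding bilinear_conv_bounded_bilinear[symmetric] bilinear_def
  by (auto intro!: linearI
      simp: matrix_add_ldistrib matrix_scalar_ac scalar_matrix_assoc)
    (simp add: matrix_matrix_mult_def vec_eq_iff sum.distrib distrib_right)

interpretation mmult: bounded_bilinear "(**) :: real^'n^'m \<Rightarrow> real^'p^'n \<Rightarrow> real^'p^'m"
  by (rule bounded_bilinear_matrix_mult)

lemmas mmult_simps = mmult.add_left mmult.add_right mmult.diff_left mmult.diff_right
  mmult.minus_left mmult.minus_right mmult.scaleR_left mmult.scaleR_right
  mmult.zero_left mmult.zero_right

lemma bounded_linear_transpose: "bounded_linear (transpose :: real^'n^'m \<Rightarrow> real^'m^'n)"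
  unfolding linear_conv_bounded_linear[symmetric]
  by (auto intro!: linearI simp: transpose_def vec_eq_iff)

lemmas transpose_add = linear_add[OF bounded_linear.linear[OF bounded_linear_transpose]]
  and transpose_diff = linear_diff[OF bounded_linear.linear[OF bounded_linear_transpose]]
  and transpose_minus = linear_neg[OF bounded_linear.linear[OF bounded_linear_transpose]]

lemmas transpose_simps = transpose_add transpose_diff transpose_minus transpose_scalar
  matrix_transpose_mul transpose_mat

text \<open>\<open>matrix_inv\<close> is a Hilbert choice. A right inverse of a square matrix is
  two-sided, and two-sided inverses are unique, which pins the choice down.\<close>

lemma matrix_inv_eqI:
  fixes A :: "real^'n^'n"
  assumes "A ** B = mat 1"
  shows "matrix_inv A = B"
proof -
  have B: "B ** A = mat 1" using assms matrix_left_right_inverse by blast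
  have "A ** matrix_inv A = mat 1 \<and> matrix_inv A ** A = mat 1"
    unfolding matrix_inv_def by (rule someI[of _ B]) (simp add: assms B)
  then show ?thesis by (metis B matrix_mul_assoc matrix_mul_lid matrix_mul_rid)
qed

lemma matrix_inv_works:
  fixes A :: "real^'n^'n"
  assumes "invertible A"
  shows matrix_inv_right: "A ** matrix_inv A = mat 1"
    and matrix_inv_left: "matrix_inv A ** A = mat 1"
proof -
  obtain B where "A ** B = mat 1" "B ** A = mat 1" using assms unfolding invertible_def by blast
  then show "A ** matrix_inv A = mat 1" "matrix_inv A ** A = mat 1"
    using matrix_inv_eqI by metis+
qed

section \<open>Smoothness of matrix inversion\<close>

lemma continuous_on_det:
  fixes f :: "'a::topological_space \<Rightarrow> real^'n^'n"
  assumes "\<And>i j. continuous_on S (\<lambda>x. f x $ i $ j)"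
  shows "continuous_on S (\<lambda>x. det (f x))"
  unfolding det_def by (intro continuous_intros assms)

lemma open_invertible: "open {A :: real^'n^'n. invertible A}"
  unfolding invertible_det_nz
  by (intro open_Collect_neq continuous_on_det continuous_intros)

text \<open>Cramer's rule, applied to the columns \<open>axis k 1\<close>, writes each entry of the
  inverse as a quotient of determinants.\<close>

lemma continuous_on_matrix_inv:
  "continuous_on {A :: real^'n^'n. invertible A} matrix_inv"
proof -
  have eq: "matrix_inv A = (\<chi> i k. det (\<chi> r c. if c = i then axis k 1 $ r else A $ r $ c) / det A)"
    if "invertible A" for A :: "real^'n^'n"
  proof -
    have "A *v (matrix_inv A *v axis k 1) = axis k 1" for k
      by (simp add: matrix_vector_mul_assoc matrix_inv_right[OF that])
    moreover have "det A \<noteq> 0" using that invertible_det_nz by blast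
    ultimately have "matrix_inv A *v axis k 1
        = (\<chi> i. det (\<chi> r c. if c = i then axis k 1 $ r else A $ r $ c) / det A)" for k
      using cramer by blast
    then have "(matrix_inv A *v axis k 1) $ i
        = det (\<chi> r c. if c = i then axis k 1 $ r else A $ r $ c) / det A" for i k
      by simp
    then show ?thesis
      by (simp add: vec_eq_iff matrix_vector_mult_basis column_def)
  qed
  have "continuous_on {A :: real^'n^'n. invertible A}
      (\<lambda>A. \<chi> i k. det (\<chi> r c. if c = i then axis k 1 $ r else A $ r $ c) / det A)"
  proof (intro continuous_on_vec_lambda continuous_on_divide)
    fix i k :: 'n
    have "continuous_on {A. invertible A}
      (\<lambda>A :: real^'n^'n. (\<chi> r c. if c = i then axis k 1 $ r else A $ r $ c) $ r $ c)" for r c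
      by (cases "c = i") (auto intro!: continuous_intros)
    then show "continuous_on {A :: real^'n^'n. invertible A}
        (\<lambda>A. det (\<chi> r c. if c = i then axis k 1 $ r else A $ r $ c))"
      by (rule continuous_on_det)
    show "continuous_on {A :: real^'n^'n. invertible A} det"
      by (intro continuous_on_det continuous_intros)
  qed (auto simp: invertible_det_nz)
  then show ?thesis by (rule continuous_on_eq) (rule eq[symmetric], simp)
qed

text \<open>When the second factor vanishes linearly at \<open>a\<close>, mere continuity of
  \<open>g\<close> is enough: the error \<open>B (g x - g a) (L (x - a))\<close> is of smaller order
  than \<open>x - a\<close>. This allows inversion to be differentiated knowing only its
  continuity.\<close>

lemma has_derivative_bilinear_vanishing:
  assumes "bounded_bilinear B" and L: "bounded_linear L" and g: "isCont g a"
  shows "((\<lambda>x. B (g x) (L (x - a))) has_derivative (\<lambda>h. B (g a) (L h))) (at a)"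
proof -
  interpret B: bounded_bilinear B by fact
  interpret L: bounded_linear L by fact
  obtain K where K: "K > 0" "\<And>x y. norm (B x y) \<le> norm x * norm y * K"
    using B.pos_bounded by blast
  obtain C where C: "C > 0" "\<And>x. norm (L x) \<le> norm x * C" using L.pos_bounded by blast
  have "((\<lambda>x. norm (g x - g a) * (C * K)) \<longlongrightarrow> norm (g a - g a) * (C * K)) (at a)"
    using g unfolding isCont_def by (intro tendsto_intros)
  then have lim: "((\<lambda>x. norm (g x - g a) * (C * K)) \<longlongrightarrow> 0) (at a)" by simp
  have bound: "norm (B (g x - g a) (L (x - a))) / norm (x - a) \<le> norm (g x - g a) * (C * K)" for x
  proof (cases "x = a")
    case False
    have "norm (B (g x - g a) (L (x - a))) \<le> norm (g x - g a) * norm (L (x - a)) * K"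
      by (rule K)
    also have "\<dots> \<le> norm (g x - g a) * (norm (x - a) * C) * K"
      using C K by (intro mult_right_mono mult_left_mono) auto
    finally show ?thesis using False by (simp add: field_simps)
  qed (use C K in simp)
  have "((\<lambda>x. norm (B (g x - g a) (L (x - a))) / norm (x - a)) \<longlongrightarrow> 0) (at a)"
    by (rule tendsto_sandwich[OF _ _ tendsto_const lim])
       (auto intro!: always_eventually bound divide_nonneg_nonneg)
  moreover have "bounded_linear (\<lambda>h. B (g a) (L h))"
    by (rule bounded_linear_compose[OF B.bounded_linear_right L])
  ultimately show ?thesis
    unfolding has_derivative_iff_norm
    by (simp add: L.zero B.zero_right B.diff_left)
qed

text \<open>Rests on the identity \<open>X^-1 = A^-1 - X^-1 (X - A) A^-1\<close> for invertible
  \<open>X\<close>, whose last term has the form treated in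
  \<open>has_derivative_bilinear_vanishing\<close>.\<close>

lemma has_derivative_matrix_inv:
  fixes A :: "real^'n^'n"
  assumes "invertible A"
  shows "(matrix_inv has_derivative (\<lambda>X. - (matrix_inv A ** X ** matrix_inv A))) (at A)"
proof -
  have cont: "isCont matrix_inv A"
    using continuous_on_matrix_inv assms
    unfolding continuous_on_eq_continuous_at[OF open_invertible] by blast
  have L: "bounded_linear (\<lambda>X. X ** matrix_inv A)"
    by (rule mmult.bounded_linear_left)
  have "((\<lambda>X. matrix_inv A - matrix_inv X ** ((X - A) ** matrix_inv A)) has_derivative
      (\<lambda>X. - (matrix_inv A ** (X ** matrix_inv A)))) (at A)"
    using has_derivative_diff[OF has_derivative_const[of "matrix_inv A"]
        has_derivative_bilinear_vanishing[OF bounded_bilinear_matrix_mult L cont]]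
    by simp
  then have "(matrix_inv has_derivative (\<lambda>X. - (matrix_inv A ** (X ** matrix_inv A)))) (at A)"
  proof (rule has_derivative_transform_within_open[OF _ open_invertible])
    fix X :: "real^'n^'n" assume "X \<in> {A. invertible A}"
    then have X: "invertible X" by simp
    have "matrix_inv X ** ((X - A) ** matrix_inv A)
        = matrix_inv X ** X ** matrix_inv A - matrix_inv X ** (A ** matrix_inv A)"
      by (simp add: mmult_simps matrix_mul_assoc)
    then show "matrix_inv A - matrix_inv X ** ((X - A) ** matrix_inv A) = matrix_inv X"
      by (simp add: matrix_inv_works[OF X] matrix_inv_works[OF assms])
  qed (use assms in simp)
  then show ?thesis by (simp add: matrix_mul_assoc)
qed

lemma has_derivative_matrix_inv_shift:
  fixes A C :: "real^'n^'n"
  assumes "invertible (A + C)"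
  shows "((\<lambda>A. matrix_inv (A + C)) has_derivative
    (\<lambda>X. - (matrix_inv (A + C) ** X ** matrix_inv (A + C)))) (at A)"
proof -
  have "((\<lambda>A. A + C) has_derivative (\<lambda>X. X)) (at A)" by (auto intro!: derivative_eq_intros)
  from has_derivative_compose[OF this has_derivative_matrix_inv[OF assms]] show ?thesis .
qed

lemma open_invertible_shift: "open {A :: real^'n^'n. invertible (A + C)}"
  using open_vimage[OF open_invertible, of "\<lambda>A. A + C"]
  by (simp add: vimage_def continuous_on_add continuous_on_id)

text \<open>The derivative of inversion is polynomial in the inverse itself, so each order of
  differentiability yields the next.\<close>

lemma C_diff_matrix_inv_shift:
  "C_diff k {A :: real^'n^'n. invertible (A + C)} (\<lambda>A. matrix_inv (A + C))"
proof (induction k)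
  case 0
  show ?case
    using has_derivative_continuous[OF has_derivative_matrix_inv_shift]
    by (auto intro!: continuous_at_imp_continuous_on)
next
  case (Suc k)
  show ?case
    by (rule C_diff_SucI[OF open_invertible_shift has_derivative_matrix_inv_shift])
      (auto intro!: C_diff_bounded_linear[OF bounded_linear_minus[OF bounded_linear_ident]]
        C_diff_bounded_bilinear[OF bounded_bilinear_matrix_mult] open_invertible_shift
        C_diff_const Suc)
qed

section \<open>Dimensions of spaces of anticommuting matrices\<close>

text \<open>The trace of a projection, orthogonal or not, is its rank: expand \<open>P b\<close> in
  an orthonormal basis of \<open>S\<close>, exchange the sums and use \<open>P c = c\<close>.
  Dimension counts thereby become sums over matrix entries.\<close>

lemma dim_eq_trace_projection:
  fixes P :: "'a::euclidean_space \<Rightarrow> 'a"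
  assumes P: "linear P" and S: "subspace S"
    and "\<And>x. P x \<in> S" and id: "\<And>x. x \<in> S \<Longrightarrow> P x = x"
  shows "real (dim S) = (\<Sum>b\<in>Basis. P b \<bullet> b)"
proof -
  obtain B where B: "B \<subseteq> S" "pairwise orthogonal B" "\<And>x. x \<in> B \<Longrightarrow> norm x = 1"
    "independent B" "card B = dim S" "span B = S"
    using orthonormal_basis_subspace[OF S] by blast
  have fin: "finite B" using B(4) independent_imp_finite by blast
  have "(\<Sum>b\<in>Basis. P b \<bullet> b) = (\<Sum>b\<in>Basis. (\<Sum>c\<in>B. (P b \<bullet> c) *\<^sub>R c) \<bullet> b)"
    using orthonormal_basis_expand[OF B(2,3) _ fin] assms(3) B(6) by simp
  also have "\<dots> = (\<Sum>c\<in>B. \<Sum>b\<in>Basis. (P b \<bullet> c) * (c \<bullet> b))"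
    by (simp add: inner_sum_left sum.swap[of _ B])
  also have "\<dots> = (\<Sum>c\<in>B. P (\<Sum>b\<in>Basis. (c \<bullet> b) *\<^sub>R b) \<bullet> c)"
    by (simp add: linear_sum[OF P] linear_cmul[OF P] inner_sum_left mult.commute)
  also have "\<dots> = (\<Sum>c\<in>B. c \<bullet> c)"
    using id B(1) by (intro sum.cong) (auto simp: euclidean_representation)
  also have "\<dots> = real (dim S)"
    using B(3,5) by (simp add: dot_square_norm)
  finally show ?thesis ..
qed

lemma sum_Basis_matrix:
  fixes f :: "real^'n^'m \<Rightarrow> 'b::comm_monoid_add"
  shows "(\<Sum>b\<in>Basis. f b) = (\<Sum>i\<in>UNIV. \<Sum>j\<in>UNIV. f (axis i (axis j 1)))"
proof -
  have "(\<Sum>i\<in>UNIV. \<Sum>j\<in>UNIV. f (axis i (axis j 1)))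
      = (\<Sum>p\<in>UNIV. f (case p of (i, j) \<Rightarrow> axis i (axis j 1)))"
    by (simp add: sum.cartesian_product case_prod_unfold)
  also have "\<dots> = (\<Sum>b\<in>Basis. f b)"
  proof (rule sum.reindex_bij_betw)
    show "bij_betw (\<lambda>p. case p of (i, j) \<Rightarrow> (axis i (axis j 1) :: real^'n^'m)) UNIV Basis"
      by (fastforce simp: bij_betw_def inj_on_def axis_eq_axis Basis_vec_def)
  qed
  finally show ?thesis ..
qed

lemma mult_axis_mult_nth:
  fixes A B :: "real^'n^'n"
  shows "(A ** axis i (axis j 1) ** B) $ k $ l = A $ k $ i * B $ j $ l"
proof -
  have "(A ** axis i (axis j 1)) $ k $ c = (if c = j then A $ k $ i else 0)" for c
    by (simp add: matrix_matrix_mult_def axis_def if_distrib[of "\<lambda>x. x $ _"]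
        if_distrib[of "\<lambda>x. _ * x"] cong: if_cong)
  then show ?thesis
    by (simp add: matrix_matrix_mult_def[of "A ** _"] if_distrib[of "\<lambda>x. x * _"] cong: if_cong)
qed

lemma transpose_axis_axis: "transpose (axis i (axis j (1::real))) = axis j (axis i 1)"
  by (auto simp: transpose_def axis_def vec_eq_iff)

lemma inner_matrix_eq_trace: "(A :: real^'n^'m) \<bullet> B = trace (A ** transpose B)"
  by (simp add: trace_def matrix_matrix_mult_def transpose_def inner_vec_def)

lemma trace_transpose: "trace (transpose A) = trace (A :: real^'n^'n)"
  by (simp add: trace_def transpose_def)

text \<open>\<open>A\<close> is skew for an inner product that it preserves. Hence
  \<open>transpose A\<close> is conjugate to \<open>- A\<close>, while it has the same trace as
  \<open>A\<close>.\<close>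

lemma trace_complex_structure:
  fixes A :: "real^'n^'n"
  assumes "A ** A = - mat 1"
  shows "trace A = 0"
proof -
  \<comment> \<open>\<open>G\<close> is the Gram matrix of an \<open>A\<close>-invariant inner product.\<close>
  define G where "G = mat 1 + transpose A ** A"
  have G: "(G *v x) \<bullet> x = x \<bullet> x + (A *v x) \<bullet> (A *v x)" for x
    by (simp add: G_def matrix_vector_mult_add_rdistrib inner_add_left dot_lmul_matrix
        flip: matrix_vector_mul_assoc)
  have "G *v x = 0 \<Longrightarrow> x = 0" for x
    using G[of x] by (metis inner_eq_zero_iff inner_ge_zero inner_zero_left add_nonneg_eq_0_iff)
  then have "\<exists>B. B ** G = mat 1" by (simp add: matrix_left_invertible_ker)
  then obtain H where H: "H ** G = mat 1" "G ** H = mat 1"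
    using matrix_left_right_inverse by blast
  have TT: "transpose A ** transpose A = - mat 1"
    by (metis assms matrix_transpose_mul transpose_minus transpose_mat)
  have "transpose A ** G = transpose A - A"
    by (simp add: G_def mmult_simps matrix_mul_assoc TT)
  moreover have "G ** A = A - transpose A"
    by (simp add: G_def mmult_simps assms flip: matrix_mul_assoc)
  ultimately have "transpose A ** G = - (G ** A)" by simp
  then have "transpose A ** G ** H = - (G ** A ** H)" by (simp add: mmult_simps)
  then have "transpose A = - (G ** (A ** H))" by (simp add: H flip: matrix_mul_assoc)
  then have "trace A = - trace (G ** (A ** H))"
    by (metis trace_transpose trace_sub diff_0 trace_0 mat_0)
  also have "\<dots> = - trace A"
    by (subst trace_mul_sym) (simp add: H flip: matrix_mul_assoc)
  finally show ?thesis by simp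
qed

text \<open>The model spaces of the charts: the tangent space at \<open>A\<close> of all complex
  structures and, for skew \<open>A\<close>, that of the skew ones.\<close>

abbreviation anticommuting :: "real^'n^'n \<Rightarrow> (real^'n^'n) set" where
  "anticommuting A \<equiv> {W. W ** A = - (A ** W)}"

abbreviation skew_anticommuting :: "real^'n^'n \<Rightarrow> (real^'n^'n) set" where
  "skew_anticommuting A \<equiv> {W. W ** A = - (A ** W) \<and> transpose W = - W}"

lemma subspace_anticommuting: "subspace (anticommuting A)"
  by (auto simp: subspace_def mmult_simps)

lemma subspace_skew_anticommuting: "subspace (skew_anticommuting A)"
  by (auto simp: subspace_def mmult_simps transpose_simps 
      linear_0[OF bounded_linear.linear[OF bounded_linear_transpose]])

lemma mult_square_minus_one:
  fixes A :: "real^'n^'n"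
  assumes "A ** A = - mat 1"
  shows "A ** (A ** X) = - X"
  using assms by (simp add: matrix_mul_assoc mmult_simps)

text \<open>Averaging \<open>W\<close> with \<open>A W A\<close> projects onto the anticommuting
  matrices, with trace half of \<open>N^2 + (trace A)^2\<close>, where \<open>N = CARD('n)\<close>.
  As \<open>trace A = 0\<close>, the result is the same at every \<open>A\<close>, as a manifold of
  one fixed dimension requires.\<close>

lemma dim_anticommuting:
  fixes A :: "real^'n^'n"
  assumes A: "A ** A = - mat 1"
  shows "real (dim (anticommuting A)) = (real CARD('n))\<^sup>2 / 2"
proof -
  let ?P = "\<lambda>W. (1/2) *\<^sub>R (W + A ** W ** A)"
  have "real (dim (anticommuting A)) = (\<Sum>b\<in>Basis. ?P b \<bullet> b)"
  proof (rule dim_eq_trace_projection[OF _ subspace_anticommuting])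
    show "linear ?P" by (auto intro!: linearI simp: mmult_simps algebra_simps)
    show "?P W \<in> anticommuting A" for W
      by (simp add: mmult_simps A mult_square_minus_one[OF A] scaleR_diff_right flip: matrix_mul_assoc)
    show "?P W = W" if "W \<in> anticommuting A" for W
      using that by (simp add: mmult_simps mult_square_minus_one[OF A] flip: matrix_mul_assoc)
  qed
  also have "\<dots> = (\<Sum>i\<in>UNIV. \<Sum>j\<in>UNIV. 1/2 * (1 + A $ i $ i * A $ j $ j))"
    unfolding sum_Basis_matrix by (simp add: inner_axis mult_axis_mult_nth)
  also have "\<dots> = 1/2 * (\<Sum>i\<in>UNIV. \<Sum>j\<in>UNIV. 1 + A $ i $ i * A $ j $ j)"
    by (simp only: sum_distrib_left)
  also have "\<dots> = 1/2 * ((real CARD('n))\<^sup>2 + trace A * trace A)"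
    by (simp add: trace_def sum.distrib sum_product power2_eq_square)
  finally show ?thesis by (simp add: trace_complex_structure[OF A])
qed

text \<open>The projection \<open>?P\<close> combines skew-symmetrization with the averaging of
  \<open>dim_anticommuting\<close>; the two commute because \<open>A\<close> is skew. The new term
  in its trace is the squared norm of \<open>A\<close>, which is \<open>CARD('n)\<close> since
  \<open>A\<close> is orthogonal.\<close>

lemma dim_skew_anticommuting:
  fixes A :: "real^'n^'n"
  assumes A: "A ** A = - mat 1" and T: "transpose A = - A"
  shows "real (dim (skew_anticommuting A)) = ((real CARD('n))\<^sup>2 - 2 * real CARD('n)) / 4"
proof -
  let ?P = "\<lambda>W. (1/4) *\<^sub>R (W - transpose W + A ** W ** A - A ** transpose W ** A)"
  have "real (dim (skew_anticommuting A)) = (\<Sum>b\<in>Basis. ?P b \<bullet> b)"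
  proof (rule dim_eq_trace_projection[OF _ subspace_skew_anticommuting])
    show "linear ?P" by (auto intro!: linearI simp: mmult_simps transpose_simps algebra_simps)
    show "?P W \<in> skew_anticommuting A" for W
      by (simp add: mmult_simps transpose_simps T A mult_square_minus_one[OF A]
          flip: matrix_mul_assoc) (simp add: vec_eq_iff algebra_simps)
    show "?P W = W" if "W \<in> skew_anticommuting A" for W
    proof -
      have "A ** W ** A = W" "transpose W = - W"
        using that by (simp_all add: mmult_simps mult_square_minus_one[OF A] flip: matrix_mul_assoc)
      then show ?thesis by (simp add: mmult_simps)
    qed
  qed
  also have "\<dots> = (\<Sum>i\<in>UNIV. \<Sum>j\<in>UNIV. 1/4 *
      (1 - (if i = j then 1 else 0) + A $ i $ i * A $ j $ j - A $ i $ j * A $ i $ j))"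
    unfolding sum_Basis_matrix
  proof (intro sum.cong refl)
    fix i j :: 'n
    have "axis j (axis i (1::real)) $ i $ j = (if i = j then 1 else 0)"
      by (cases "i = j") (simp_all add: axis_def)
    then show "?P (axis i (axis j 1)) \<bullet> axis i (axis j 1)
        = 1/4 * (1 - (if i = j then 1 else 0) + A $ i $ i * A $ j $ j - A $ i $ j * A $ i $ j)"
      by (simp only: transpose_axis_axis inner_axis inner_scaleR_left vector_add_component
          vector_minus_component mult_axis_mult_nth axis_nth vector_scaleR_component) simp
  qed
  also have "\<dots> = 1/4 * (\<Sum>i\<in>UNIV. \<Sum>j\<in>UNIV.
      1 - (if i = j then 1 else 0) + A $ i $ i * A $ j $ j - A $ i $ j * A $ i $ j)"
    by (simp only: sum_distrib_left)
  also have "\<dots> = 1/4 * ((real CARD('n))\<^sup>2 - real CARD('n) + trace A * trace A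
      - (\<Sum>i\<in>UNIV. \<Sum>j\<in>UNIV. A $ i $ j * A $ i $ j))"
    by (simp add: trace_def sum.distrib sum_subtractf sum_product power2_eq_square) (simp add: algebra_simps)
  also have "(\<Sum>i\<in>UNIV. \<Sum>j\<in>UNIV. A $ i $ j * A $ i $ j) = trace (A ** transpose A)"
    by (simp add: trace_def matrix_matrix_mult_def transpose_def)
  also have "\<dots> = real CARD('n)" by (simp add: T mmult_simps A trace_I)
  finally show ?thesis by (simp add: trace_complex_structure[OF A])
qed

section \<open>Cayley charts\<close>

text \<open>A Cayley transform.  If \<open>W\<close> anticommutes with \<open>A0\<close>, then
  \<open>cayley_inv A0 W = (1 + W) A0 (1 + W)\<^sup>-\<^sup>1\<close>, so the solutions of \<open>A\<^sup>2 = -1\<close> near \<open>A0\<close> correspond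
  to a linear subspace.\<close>

definition cayley :: "real^'n^'n \<Rightarrow> real^'n^'n \<Rightarrow> real^'n^'n" where
  "cayley A0 A = 2 *\<^sub>R (matrix_inv (A + A0) ** A0) - mat 1"

definition cayley_inv :: "real^'n^'n \<Rightarrow> real^'n^'n \<Rightarrow> real^'n^'n" where
  "cayley_inv A0 W = 2 *\<^sub>R (A0 ** matrix_inv (W + mat 1)) - A0"

text \<open>In the form chosen for the transform the variable occurs only inside a single inverse,
  so smoothness is inherited from matrix inversion.\<close>

lemma smooth_cayley: "smooth {A. invertible (A + A0)} (cayley A0)"
proof -
  have "C_diff k {A. invertible (A + A0)} (\<lambda>A. 2 *\<^sub>R (matrix_inv (A + A0) ** A0) + - mat 1)" for k
    by (intro C_diff_add open_invertible_shift C_diff_const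
        C_diff_bounded_linear[OF bounded_linear_scaleR_right]
        C_diff_bounded_bilinear[OF bounded_bilinear_matrix_mult] C_diff_matrix_inv_shift)
  then show ?thesis by (simp add: smooth_def cayley_def[abs_def])
qed

lemma smooth_cayley_inv: "smooth {W. invertible (W + mat 1)} (cayley_inv A0)"
proof -
  have "C_diff k {W. invertible (W + mat 1)} (\<lambda>W. 2 *\<^sub>R (A0 ** matrix_inv (W + mat 1)) + - A0)" for k
    by (intro C_diff_add open_invertible_shift C_diff_const
        C_diff_bounded_linear[OF bounded_linear_scaleR_right]
        C_diff_bounded_bilinear[OF bounded_bilinear_matrix_mult] C_diff_matrix_inv_shift)
  then show ?thesis by (simp add: smooth_def cayley_inv_def[abs_def])
qed

lemma frechet_derivative_cayley:
  assumes "invertible (A + A0)"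
  shows "frechet_derivative (cayley A0) (at A)
    = (\<lambda>X. - 2 *\<^sub>R (matrix_inv (A + A0) ** X ** matrix_inv (A + A0) ** A0))"
proof -
  have "(cayley A0 has_derivative
      (\<lambda>X. 2 *\<^sub>R (- (matrix_inv (A + A0) ** X ** matrix_inv (A + A0)) ** A0) - 0)) (at A)"
    unfolding cayley_def[abs_def]
    by (intro has_derivative_diff has_derivative_const has_derivative_scaleR_right
        bounded_linear.has_derivative[OF mmult.bounded_linear_left]
        has_derivative_matrix_inv_shift assms)
  then show ?thesis
    by (subst frechet_derivative_at[symmetric]) (auto simp: mmult_simps)
qed

text \<open>Adding 1 to the transform leaves \<open>2 (A + A0)^-1 A0\<close>, and
  \<open>A0^-1 = - A0\<close>. The explicit inverse shows that the image lies in the target and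
  evaluates \<open>matrix_inv\<close> when the two transforms are composed.\<close>

lemma cayley_add_one_right_inverse:
  fixes A0 :: "real^'n^'n"
  assumes A0: "A0 ** A0 = - mat 1" and "invertible (A + A0)"
  shows "(cayley A0 A + mat 1) ** (- (1/2) *\<^sub>R (A0 ** (A + A0))) = mat 1"
proof -
  have "(cayley A0 A + mat 1) ** (- (1/2) *\<^sub>R (A0 ** (A + A0)))
      = matrix_inv (A + A0) ** (- (A0 ** (A0 ** (A + A0))))"
    unfolding cayley_def
    by (simp add: mmult.scaleR_left mmult.scaleR_right mmult.minus_right flip: matrix_mul_assoc)
  then show ?thesis
    by (simp only: mult_square_minus_one[OF A0] minus_minus matrix_inv_left[OF assms(2)])
qed

lemma cayley_inv_add_right_inverse:
  fixes A0 :: "real^'n^'n"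
  assumes A0: "A0 ** A0 = - mat 1" and W: "invertible (W + mat 1)"
  shows "(cayley_inv A0 W + A0) ** (- (1/2) *\<^sub>R ((W + mat 1) ** A0)) = mat 1"
proof -
  have "(cayley_inv A0 W + A0) ** (- (1/2) *\<^sub>R ((W + mat 1) ** A0))
      = - (A0 ** (matrix_inv (W + mat 1) ** (W + mat 1)) ** A0)"
    unfolding cayley_inv_def
    by (simp add: mmult.scaleR_left mmult.scaleR_right mmult.minus_right flip: matrix_mul_assoc)
  then show ?thesis using A0 by (simp add: matrix_inv_left[OF W])
qed

lemma diffeo_cayley:
  fixes A0 :: "real^'n^'n"
  assumes A0: "A0 ** A0 = - mat 1"
  shows "diffeo {A. invertible (A + A0)} {W. invertible (W + mat 1)} (cayley A0) (cayley_inv A0)"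
    (is "diffeo ?U ?V _ _")
proof -
  have 1: "cayley A0 A \<in> ?V" if "A \<in> ?U" for A
    using cayley_add_one_right_inverse[OF A0] that by (auto simp: invertible_right_inverse)
  have 2: "cayley_inv A0 W \<in> ?U" if "W \<in> ?V" for W
    using cayley_inv_add_right_inverse[OF A0] that by (auto simp: invertible_right_inverse)
  have 3: "cayley_inv A0 (cayley A0 A) = A" if "A \<in> ?U" for A
    using cayley_add_one_right_inverse[OF A0, of A, THEN matrix_inv_eqI] that
    by (simp add: cayley_inv_def mmult.scaleR_right mmult.minus_right mult_square_minus_one[OF A0])
  have 4: "cayley A0 (cayley_inv A0 W) = W" if "W \<in> ?V" for W
    using cayley_inv_add_right_inverse[OF A0, of W, THEN matrix_inv_eqI] that
    by (simp add: cayley_def mmult_simps A0 flip: matrix_mul_assoc)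
  have "W \<in> cayley A0 ` ?U" if "W \<in> ?V" for W
    by (rule image_eqI[OF _ 2[OF that]]) (simp only: 4[OF that])
  then have "cayley A0 ` ?U = ?V" using 1 by blast
  moreover have "A \<in> cayley_inv A0 ` ?V" if "A \<in> ?U" for A
    by (rule image_eqI[OF _ 1[OF that]]) (simp only: 3[OF that])
  then have "cayley_inv A0 ` ?V = ?U" using 2 by blast
  ultimately show ?thesis
    unfolding diffeo_def
    by (intro conjI ballI open_invertible_shift smooth_cayley smooth_cayley_inv 3 4)
qed

text \<open>Both \<open>(A + A0) A0\<close> and \<open>A (A + A0)\<close> equal
  \<open>A A0 - 1\<close>, so \<open>A + A0\<close> intertwines the two structures. Linearization,
  holomorphy and skewness of the chart all use this.\<close>

lemma matrix_inv_add_conjugate: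
  fixes A0 :: "real^'n^'n"
  assumes A: "A ** A = - mat 1" and A0: "A0 ** A0 = - mat 1" and i: "invertible (A + A0)"
  shows "matrix_inv (A + A0) ** A = A0 ** matrix_inv (A + A0)"
proof -
  let ?Q = "matrix_inv (A + A0)"
  have "(A + A0) ** A0 = A ** (A + A0)" by (simp add: mmult_simps A A0)
  then have "?Q ** ((A + A0) ** A0) ** ?Q = ?Q ** (A ** (A + A0)) ** ?Q" by simp
  then have "?Q ** (A + A0) ** A0 ** ?Q = ?Q ** A ** ((A + A0) ** ?Q)"
    by (simp only: matrix_mul_assoc)
  then show ?thesis by (simp add: matrix_inv_works[OF i])
qed

text \<open>The intertwining relation gives \<open>A0 Q A0 = A0 + Q\<close> for
  \<open>Q = (A + A0)^-1\<close>. Hence multiplying the transform by \<open>A0\<close> gives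
  \<open>A0 + 2 Q\<close> from the left and its negative from the right.\<close>

lemma cayley_anticommuting:
  fixes A0 :: "real^'n^'n"
  assumes A: "A ** A = - mat 1" and A0: "A0 ** A0 = - mat 1" and i: "invertible (A + A0)"
  shows "cayley A0 A ** A0 = - (A0 ** cayley A0 A)"
proof -
  let ?Q = "matrix_inv (A + A0)"
  have "A0 ** ?Q ** A0 = ?Q ** A ** A0" by (simp only: matrix_inv_add_conjugate[OF assms])
  also have "\<dots> = ?Q ** (A + A0) ** A0 - ?Q ** A0 ** A0" by (simp add: mmult_simps)
  also have "\<dots> = A0 + ?Q"
    unfolding matrix_inv_left[OF i] by (simp add: mmult_simps A0 flip: matrix_mul_assoc)
  finally have "A0 ** (?Q ** A0) = A0 + ?Q" by (simp add: matrix_mul_assoc)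
  then have "A0 ** cayley A0 A = 2 *\<^sub>R (A0 + ?Q) - A0"
    by (simp only: cayley_def mmult.diff_right mmult.scaleR_right matrix_mul_rid)
  moreover have "cayley A0 A ** A0 = - (2 *\<^sub>R ?Q) - A0"
    by (simp add: cayley_def mmult.diff_left mmult.scaleR_left mmult.minus_right A0 flip: matrix_mul_assoc)
  ultimately show ?thesis by (simp only: scaleR_2) simp
qed

lemma cayley_inv_complex_structure:
  fixes A0 :: "real^'n^'n"
  assumes A0: "A0 ** A0 = - mat 1" and W: "W ** A0 = - (A0 ** W)" and i: "invertible (W + mat 1)"
  shows "cayley_inv A0 W ** cayley_inv A0 W = - mat 1"
proof -
  let ?R = "matrix_inv (W + mat 1)"
  \<comment> \<open>Anticommutation, rephrased for \<open>W + mat 1\<close>. Multiplying by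
    \<open>?R\<close> on both sides and by \<open>A0\<close> from the left gives relation
    \<open>e\<close>, which cancels everything but \<open>- mat 1\<close> in the expanded
    square.\<close>
  have "A0 ** (W + mat 1) = 2 *\<^sub>R A0 - (W + mat 1) ** A0"
    using W by (simp add: mmult_simps scaleR_2)
  then have "?R ** (A0 ** (W + mat 1)) ** ?R = ?R ** (2 *\<^sub>R A0 - (W + mat 1) ** A0) ** ?R" by simp
  then have "?R ** A0 ** ((W + mat 1) ** ?R) = 2 *\<^sub>R (?R ** A0 ** ?R) - ?R ** (W + mat 1) ** A0 ** ?R"
    by (simp only: mmult.diff_left mmult.diff_right mmult.scaleR_left mmult.scaleR_right matrix_mul_assoc)
  then have "?R ** A0 = 2 *\<^sub>R (?R ** A0 ** ?R) - A0 ** ?R"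
    by (simp add: matrix_inv_works[OF i])
  then have "A0 ** (?R ** A0) = A0 ** (2 *\<^sub>R (?R ** A0 ** ?R) - A0 ** ?R)" by simp
  then have e: "A0 ** (?R ** A0) = 2 *\<^sub>R (A0 ** (?R ** (A0 ** ?R))) + ?R"
    by (simp add: mmult_simps mult_square_minus_one[OF A0] flip: matrix_mul_assoc)
  have "cayley_inv A0 W ** cayley_inv A0 W
      = 4 *\<^sub>R (A0 ** (?R ** (A0 ** ?R))) - 2 *\<^sub>R (A0 ** (?R ** A0)) + 2 *\<^sub>R ?R - mat 1"
  proof -
    have "cayley_inv A0 W ** cayley_inv A0 W
      = 2 *\<^sub>R (A0 ** ?R) ** 2 *\<^sub>R (A0 ** ?R) - 2 *\<^sub>R (A0 ** ?R) ** A0 - A0 ** 2 *\<^sub>R (A0 ** ?R) - mat 1"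
      by (simp only: cayley_inv_def mmult.diff_left mmult.diff_right A0) simp
    then show ?thesis
      by (simp add: mmult.scaleR_left mmult.scaleR_right mult_square_minus_one[OF A0] flip: matrix_mul_assoc)
  qed
  also have "\<dots> = - mat 1"
    unfolding e scaleR_add_right by simp
  finally show ?thesis .
qed

lemma matrix_inv_transpose:
  fixes A :: "real^'n^'n"
  assumes "invertible A"
  shows "transpose (matrix_inv A) = matrix_inv (transpose A)"
  using matrix_inv_left[OF assms] matrix_inv_eqI by (metis matrix_transpose_mul transpose_mat)

text \<open>\<open>Q = (A + A0)^-1\<close> is skew, so transposing turns \<open>Q A0\<close> into
  \<open>A0 Q = Q A\<close>; finally \<open>Q A + Q A0 = 1\<close> changes \<open>2 Q A - 1\<close>
  into \<open>1 - 2 Q A0\<close>.\<close>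

lemma cayley_skew:
  fixes A0 :: "real^'n^'n"
  assumes A: "A ** A = - mat 1" and A0: "A0 ** A0 = - mat 1" and i: "invertible (A + A0)"
    and T: "transpose A = - A" "transpose A0 = - A0"
  shows "transpose (cayley A0 A) = - cayley A0 A"
proof -
  let ?Q = "matrix_inv (A + A0)"
  have "transpose (A + A0) = - (A + A0)" by (simp add: transpose_simps T)
  then have "transpose (A + A0) ** - ?Q = mat 1"
    by (simp only: mmult.minus_left mmult.minus_right minus_minus matrix_inv_right[OF i])
  then have "transpose ?Q = - ?Q"
    by (simp add: matrix_inv_transpose[OF i] matrix_inv_eqI)
  then have "transpose (cayley A0 A) = 2 *\<^sub>R (?Q ** A) - mat 1"
    by (simp add: cayley_def transpose_simps T mmult_simps matrix_inv_add_conjugate[OF A A0 i])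
  moreover have "?Q ** A + ?Q ** A0 = mat 1"
    by (simp add: matrix_inv_left[OF i] flip: mmult.add_right)
  then have "?Q ** A = mat 1 - ?Q ** A0" by (simp add: eq_diff_eq)
  ultimately show ?thesis
    by (simp only: cayley_def scaleR_2) simp
qed

text \<open>The transpose of \<open>1 + W\<close> is \<open>1 - W\<close>, and moving it past
  \<open>A0\<close> turns it into \<open>1 + W\<close>. Consequently
  \<open>A0 R = transpose R A0\<close> for \<open>R = (W + 1)^-1\<close>.\<close>

lemma cayley_inv_skew:
  fixes A0 :: "real^'n^'n"
  assumes W: "W ** A0 = - (A0 ** W)" and i: "invertible (W + mat 1)"
    and T: "transpose W = - W" "transpose A0 = - A0"
  shows "transpose (cayley_inv A0 W) = - cayley_inv A0 W"
proof -
  let ?R = "matrix_inv (W + mat 1)"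
  have t: "transpose ?R ** transpose (W + mat 1) = mat 1"
    by (simp add: matrix_inv_right[OF i] flip: matrix_transpose_mul)
  have "transpose (W + mat 1) ** A0 = A0 ** (W + mat 1)"
    by (simp add: transpose_simps T mmult_simps W)
  then have "transpose ?R ** (transpose (W + mat 1) ** A0) ** ?R
      = transpose ?R ** (A0 ** (W + mat 1)) ** ?R" by simp
  then have "transpose ?R ** transpose (W + mat 1) ** A0 ** ?R
      = transpose ?R ** A0 ** ((W + mat 1) ** ?R)"
    by (simp only: matrix_mul_assoc)
  then have "A0 ** ?R = transpose ?R ** A0" by (simp add: matrix_inv_right[OF i] t)
  then show ?thesis
    by (simp add: cayley_inv_def transpose_simps T mmult_simps)
qed

section \<open>The orthogonal twistor space and its complex charts\<close>

lemma complex_structures_eq: "complex_structures = {A :: real^'n^'n. A ** A = - mat 1}"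
proof -
  have "invertible A" if "A ** A = - mat 1" for A :: "real^'n^'n"
    using that unfolding invertible_right_inverse
    by (intro exI[of _ "- A"]) (simp add: mmult_simps)
  then show ?thesis by (auto simp: complex_structures_def)
qed

abbreviation skew_complex_structures :: "(real^'n^'n) set" where
  "skew_complex_structures \<equiv> {A. A ** A = - mat 1 \<and> transpose A = - A}"

lemma uminus_matrix_vector_mult: "(- A) *v x = - (A *v (x :: real^'n))"
  by (simp add: matrix_vector_mult_def vec_eq_iff sum_negf)

text \<open>\<open>A\<close> rotates the orthonormal pair \<open>e\<close>, \<open>e0\<close> and
  preserves its orthogonal complement isometrically, so it is orthogonal. An orthogonal matrix with
  square -1 is skew.\<close>

lemma orth_twistor_space_imp_skew:
  assumes A: "A \<in> orth_twistor_space i0"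
  shows "A ** A = - mat 1 \<and> transpose A = - A"
proof -
  define e where "e = e_minus1 i0"
  define e0 where "e0 = A *v e"
  have AA: "A ** A = - mat 1"
    using A by (auto simp: orth_twistor_space_def twistor_space_def complex_structures_eq)
  have e: "e \<bullet> e = 1" by (simp add: e_def inner_axis_axis)
  have e0: "e0 \<bullet> e0 = 1" "e0 \<bullet> e = 0" "e \<bullet> e0 = 0"
    using A by (auto simp: orth_twistor_space_def twistor_space_def twistor_proj_def
        sphere_perp_def e0_def e_def norm_eq_1 inner_commute)
  have Ae0: "A *v e0 = - e"
    by (simp add: e0_def matrix_vector_mul_assoc AA uminus_matrix_vector_mult)
  let ?T = "{v. v \<bullet> e = 0 \<and> v \<bullet> e0 = 0}"
  have T: "A *v v \<in> ?T" if "v \<in> ?T" for v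
    using A that by (auto simp: orth_twistor_space_def twistor_space_def twistor_proj_def
        sphere_tangent_def e0_def e_def)
  have orth: "(A *v v) \<bullet> (A *v w) = v \<bullet> w" if "v \<in> ?T" "w \<in> ?T" for v w
    using A that by (auto simp: orth_twistor_space_def twistor_proj_def
        sphere_tangent_def e0_def e_def)
  \<comment> \<open>The orthogonal projection of \<open>v\<close> to the tangent space of the sphere
    at \<open>e0\<close>.\<close>
  define u where "u v = v - (v \<bullet> e) *\<^sub>R e - (v \<bullet> e0) *\<^sub>R e0" for v
  have u: "u v \<in> ?T" for v by (simp add: u_def inner_diff_left e e0)
  have dec: "v = (v \<bullet> e) *\<^sub>R e + (v \<bullet> e0) *\<^sub>R e0 + u v" for v by (simp add: u_def)
  have Av: "A *v v = (v \<bullet> e) *\<^sub>R e0 - (v \<bullet> e0) *\<^sub>R e + A *v u v" for v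
    by (subst dec[of v]) (simp add: matrix_vector_right_distrib matrix_vector_mult_scaleR Ae0 flip: e0_def)
  have "(A *v v) \<bullet> (A *v w) = v \<bullet> w" for v w
  proof -
    have [simp]: "e \<bullet> (A *v u x) = 0" "e0 \<bullet> (A *v u x) = 0" "(A *v u x) \<bullet> e = 0" "(A *v u x) \<bullet> e0 = 0" for x
      using T[OF u] by (auto simp: inner_commute)
    have [simp]: "e \<bullet> u x = 0" "e0 \<bullet> u x = 0" "u x \<bullet> e = 0" "u x \<bullet> e0 = 0" for x
      using u by (auto simp: inner_commute)
    have "(A *v v) \<bullet> (A *v w) = (v \<bullet> e) * (w \<bullet> e) + (v \<bullet> e0) * (w \<bullet> e0) + u v \<bullet> u w"
      unfolding Av[of v] Av[of w]
      by (simp add: inner_add_left inner_add_right inner_diff_left inner_diff_right e e0 orth[OF u u])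
    also have "\<dots> = ((v \<bullet> e) *\<^sub>R e + (v \<bullet> e0) *\<^sub>R e0 + u v) \<bullet> ((w \<bullet> e) *\<^sub>R e + (w \<bullet> e0) *\<^sub>R e0 + u w)"
      by (simp add: inner_add_left inner_add_right e e0)
    also have "\<dots> = v \<bullet> w" by (simp only: dec[symmetric])
    finally show ?thesis .
  qed
  then have "orthogonal_transformation ((*v) A)"
    by (simp add: orthogonal_transformation_def)
  then have "transpose A ** A = mat 1"
    by (simp add: orthogonal_transformation_matrix orthogonal_matrix)
  then have "transpose A ** A ** A = A" by simp
  then have "- transpose A = A" by (simp add: AA mmult_simps flip: matrix_mul_assoc)
  then show ?thesis using AA by (metis minus_minus)
qed

lemma inner_matrix_vector_mult: "(A *v x) \<bullet> y = x \<bullet> (transpose A *v (y :: real^'n))"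
  by (metis dot_lmul_matrix transpose_matrix_vector transpose_transpose)

text \<open>Skewness with square -1 gives an isometry with \<open>A v\<close> orthogonal to
  \<open>v\<close>, which puts \<open>A e\<close> on the sphere; by skewness the complement of
  \<open>e\<close> and \<open>A e\<close> is invariant.\<close>

lemma skew_imp_orth_twistor_space:
  fixes A :: "real^'n^'n"
  assumes AA: "A ** A = - mat 1" and T: "transpose A = - A"
  shows "A \<in> orth_twistor_space i0"
proof -
  have AAv: "A *v (A *v v) = - v" for v
    by (simp add: matrix_vector_mul_assoc AA uminus_matrix_vector_mult)
  have skew: "(A *v v) \<bullet> w = - (v \<bullet> (A *v w))" for v w
    by (simp add: inner_matrix_vector_mult T uminus_matrix_vector_mult)
  have orth: "(A *v v) \<bullet> (A *v w) = v \<bullet> w" for v w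
    by (simp add: skew AAv)
  have "(A *v v) \<bullet> v = 0" for v
    using skew[of v v] by (simp add: inner_commute)
  then have "twistor_proj i0 A \<in> sphere_perp i0"
    by (simp add: sphere_perp_def twistor_proj_def norm_eq_1 orth inner_axis_axis)
  then show ?thesis
    using AA by (auto simp: orth_twistor_space_def twistor_space_def complex_structures_eq
        sphere_tangent_def twistor_proj_def orth) (simp add: skew)
qed

lemma orth_twistor_space_eq: "orth_twistor_space i0 = skew_complex_structures"
  using orth_twistor_space_imp_skew skew_imp_orth_twistor_space by blast

section \<open>Cayley transforms as complex charts and the submanifold structure\<close>

lemma slice_chart_cayley:
  fixes A0 :: "real^'n^'n"
  assumes "A0 ** A0 = - mat 1"
  shows "slice_chart {A. A ** A = - mat 1} {A. invertible (A + A0)} {W. invertible (W + mat 1)}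
    (cayley A0) (cayley_inv A0) (anticommuting A0)"
proof -
  let ?U = "{A. invertible (A + A0)}" and ?V = "{W :: real^'n^'n. invertible (W + mat 1)}"
  have d: "cayley A0 ` ?U = ?V" "cayley_inv A0 ` ?V = ?U"
    "\<And>W. W \<in> ?V \<Longrightarrow> cayley A0 (cayley_inv A0 W) = W"
    using diffeo_cayley[OF assms] by (auto simp: diffeo_def)
  have "cayley A0 ` (?U \<inter> {A. A ** A = - mat 1}) \<subseteq> ?V \<inter> anticommuting A0"
    using d(1) cayley_anticommuting[OF _ assms] by blast
  moreover have "W \<in> cayley A0 ` (?U \<inter> {A. A ** A = - mat 1})" if "W \<in> ?V \<inter> anticommuting A0" for W
    using that d(2) cayley_inv_complex_structure[OF assms, of W]
    by (intro image_eqI[of _ _ "cayley_inv A0 W"]) (auto simp: d(3))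
  ultimately show ?thesis
    unfolding slice_chart_def using diffeo_cayley[OF assms] subspace_anticommuting by blast
qed

text \<open>A chart of all complex structures centred at a skew \<open>A0\<close> also straightens
  the skew ones. The same map thus serves as their own chart and as the adapted chart of the ambient
  manifold.\<close>

lemma cayley_image_skew:
  fixes A0 :: "real^'n^'n"
  assumes "A0 ** A0 = - mat 1" "transpose A0 = - A0"
  shows "cayley A0 ` ({A. invertible (A + A0)} \<inter> skew_complex_structures)
    = {W. invertible (W + mat 1)} \<inter> skew_anticommuting A0"
proof -
  let ?U = "{A. invertible (A + A0)}" and ?V = "{W :: real^'n^'n. invertible (W + mat 1)}"
  have d: "cayley A0 ` ?U = ?V" "cayley_inv A0 ` ?V = ?U"
    "\<And>W. W \<in> ?V \<Longrightarrow> cayley A0 (cayley_inv A0 W) = W"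
    using diffeo_cayley[OF assms(1)] by (auto simp: diffeo_def)
  have "cayley A0 ` (?U \<inter> skew_complex_structures) \<subseteq> ?V \<inter> skew_anticommuting A0"
    using d(1) cayley_anticommuting[OF _ assms(1)] cayley_skew[OF _ assms(1) _ _ assms(2)] by blast
  moreover have "W \<in> cayley A0 ` (?U \<inter> skew_complex_structures)" if "W \<in> ?V \<inter> skew_anticommuting A0" for W
    using that d(2) cayley_inv_complex_structure[OF assms(1), of W] cayley_inv_skew[of W A0] assms(2)
    by (intro image_eqI[of _ _ "cayley_inv A0 W"]) (auto simp: d(3))
  ultimately show ?thesis by blast
qed

lemma linear_matrix_mult_left: "linear ((**) (A :: real^'n^'n) :: real^'n^'n \<Rightarrow> _)"
  by (auto intro!: linearI simp: mmult_simps)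

text \<open>With \<open>Q = (A + A0)^-1\<close>, the differential sends \<open>X\<close> to
  \<open>-2 Q X Q A0\<close>, and \<open>Q A = A0 Q\<close> moves the structure out in front as the
  constant \<open>A0\<close>.\<close>

lemma frechet_derivative_cayley_J:
  fixes A0 :: "real^'n^'n"
  assumes "A ** A = - mat 1" "A0 ** A0 = - mat 1" "invertible (A + A0)"
  shows "frechet_derivative (cayley A0) (at A) (J_tilde A X)
    = A0 ** frechet_derivative (cayley A0) (at A) X"
  by (simp add: frechet_derivative_cayley[OF assms(3)] J_tilde_def mmult_simps matrix_mul_assoc
      matrix_inv_add_conjugate[OF assms])

lemma complex_chart_cayley:
  fixes A0 :: "real^'n^'n"
  assumes "A0 ** A0 = - mat 1"
  shows "complex_chart complex_structures J_tilde {A. invertible (A + A0)}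
    {W. invertible (W + mat 1)} (cayley A0) (cayley_inv A0) (anticommuting A0) ((**) A0)"
  unfolding complex_chart_def complex_structures_eq
proof (intro conjI ballI slice_chart_cayley[OF assms] linear_matrix_mult_left)
  show "(**) A0 ` anticommuting A0 \<subseteq> anticommuting A0"
    by (auto simp: mmult_simps matrix_mul_assoc[symmetric])
qed (simp_all add: frechet_derivative_cayley_J[OF _ assms] mult_square_minus_one[OF assms])

lemma skew_anticommuting_invariant:
  fixes A0 :: "real^'n^'n"
  assumes "transpose A0 = - A0"
  shows "(**) A0 ` skew_anticommuting A0 \<subseteq> skew_anticommuting A0"
  by (auto simp: mmult_simps transpose_simps assms matrix_mul_assoc[symmetric])

lemma complex_chart_cayley_skew:
  fixes A0 :: "real^'n^'n"
  assumes "A0 ** A0 = - mat 1" "transpose A0 = - A0"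
  shows "complex_chart skew_complex_structures J_tilde {A. invertible (A + A0)}
    {W. invertible (W + mat 1)} (cayley A0) (cayley_inv A0) (skew_anticommuting A0) ((**) A0)"
  unfolding complex_chart_def slice_chart_def
  by (intro conjI ballI diffeo_cayley[OF assms(1)] subspace_skew_anticommuting
      cayley_image_skew[OF assms] linear_matrix_mult_left skew_anticommuting_invariant[OF assms(2)])
    (simp_all add: frechet_derivative_cayley_J[OF _ assms(1)] mult_square_minus_one[OF assms(1)])

lemma invertible_add_self:
  assumes "A ** A = - mat 1"
  shows "invertible (A + A :: real^'n^'n)"
proof -
  have "A \<in> complex_structures" using assms by (simp add: complex_structures_eq)
  then show ?thesis
    using scalar_invertible[of 2 A] by (simp only: complex_structures_def mem_Collect_eq scaleR_2)
qed

text \<open>Each point lies in the chart centred at itself. The floor in the common dimension only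
  casts the real formula to a natural number.\<close>

lemma complex_manifold_complex_structures:
  "complex_manifold (complex_structures :: (real^'n^'n) set) J_tilde"
  unfolding complex_manifold_def
proof (intro exI[of _ "nat \<lfloor>(real CARD('n))\<^sup>2 / 2\<rfloor>"] ballI)
  fix A :: "real^'n^'n" assume "A \<in> complex_structures"
  then have A: "A ** A = - mat 1" by (simp add: complex_structures_eq)
  have "dim (anticommuting A) = nat \<lfloor>(real CARD('n))\<^sup>2 / 2\<rfloor>"
    unfolding dim_anticommuting[OF A, symmetric] by simp
  then show "\<exists>U V \<Phi> \<Psi> S J0. A \<in> U \<and> complex_chart complex_structures J_tilde U V \<Phi> \<Psi> S J0 \<and>
      dim S = nat \<lfloor>(real CARD('n))\<^sup>2 / 2\<rfloor>"
    by (intro exI[of _ "{B. invertible (B + A)}"] exI[of _ "{W. invertible (W + mat 1)}"]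
        exI[of _ "cayley A"] exI[of _ "cayley_inv A"] exI[of _ "anticommuting A"] exI[of _ "(**) A"]
        conjI CollectI invertible_add_self[OF A] complex_chart_cayley[OF A])
qed

lemma dim_skew_anticommuting_nat:
  fixes A :: "real^'n^'n"
  assumes "A ** A = - mat 1" "transpose A = - A"
  shows "dim (skew_anticommuting A) = nat \<lfloor>((real CARD('n))\<^sup>2 - 2 * real CARD('n)) / 4\<rfloor>"
  unfolding dim_skew_anticommuting[OF assms, symmetric] by simp

lemma complex_manifold_skew:
  "complex_manifold (skew_complex_structures :: (real^'n^'n) set) J_tilde"
  unfolding complex_manifold_def
proof (intro exI[of _ "nat \<lfloor>((real CARD('n))\<^sup>2 - 2 * real CARD('n)) / 4\<rfloor>"] ballI)
  fix A :: "real^'n^'n" assume "A \<in> skew_complex_structures"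
  then have A: "A ** A = - mat 1" "transpose A = - A" by auto
  show "\<exists>U V \<Phi> \<Psi> S J0. A \<in> U \<and> complex_chart skew_complex_structures J_tilde U V \<Phi> \<Psi> S J0 \<and>
      dim S = nat \<lfloor>((real CARD('n))\<^sup>2 - 2 * real CARD('n)) / 4\<rfloor>"
    by (intro exI[of _ "{B. invertible (B + A)}"] exI[of _ "{W. invertible (W + mat 1)}"]
        exI[of _ "cayley A"] exI[of _ "cayley_inv A"] exI[of _ "skew_anticommuting A"] exI[of _ "(**) A"]
        conjI CollectI invertible_add_self[OF A(1)] complex_chart_cayley_skew[OF A]
        dim_skew_anticommuting_nat[OF A])
qed

lemma complex_submanifold_skew:
  "complex_submanifold (skew_complex_structures :: (real^'n^'n) set) complex_structures J_tilde"
  unfolding complex_submanifold_def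
proof (intro conjI complex_manifold_complex_structures
    exI[of _ "nat \<lfloor>((real CARD('n))\<^sup>2 - 2 * real CARD('n)) / 4\<rfloor>"] ballI)
  show "skew_complex_structures \<subseteq> (complex_structures :: (real^'n^'n) set)"
    by (auto simp: complex_structures_eq)
  fix A :: "real^'n^'n" assume "A \<in> skew_complex_structures"
  then have A: "A ** A = - mat 1" "transpose A = - A" by auto
  have "skew_anticommuting A \<subseteq> anticommuting A" by auto
  then show "\<exists>U V \<Phi> \<Psi> S J0 S'. A \<in> U \<and> complex_chart complex_structures J_tilde U V \<Phi> \<Psi> S J0 \<and>
      subspace S' \<and> S' \<subseteq> S \<and> J0 ` S' \<subseteq> S' \<and>
      dim S' = nat \<lfloor>((real CARD('n))\<^sup>2 - 2 * real CARD('n)) / 4\<rfloor> \<and>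
      \<Phi> ` (U \<inter> skew_complex_structures) = V \<inter> S'"
    by (intro exI[of _ "{B. invertible (B + A)}"] exI[of _ "{W. invertible (W + mat 1)}"]
        exI[of _ "cayley A"] exI[of _ "cayley_inv A"] exI[of _ "anticommuting A"] exI[of _ "(**) A"]
        exI[of _ "skew_anticommuting A"] conjI CollectI invertible_add_self[OF A(1)]
        complex_chart_cayley[OF A(1)] subspace_skew_anticommuting
        skew_anticommuting_invariant[OF A(2)] dim_skew_anticommuting_nat[OF A]
        cayley_image_skew[OF A])
qed

section \<open>The Kaehler form\<close>

lemma ds2_eq_inner: "ds2 A X Y = 1/2 * (X \<bullet> Y) + 1/2 * ((A ** X) \<bullet> (A ** Y))"
  by (simp add: ds2_def trace_inner_def J_tilde_def flip: inner_matrix_eq_trace)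

text \<open>\<open>ds2\<close> is polynomial in the base point and both vectors, hence smooth;
  positivity already comes from its first summand.\<close>

lemma riemannian_metric_ds2: "riemannian_metric (M :: (real^'n^'n) set) ds2"
  unfolding riemannian_metric_def
proof (intro conjI ballI allI impI)
  fix A X Y Z :: "real^'n^'n" and a b
  show "ds2 A (a *\<^sub>R X + b *\<^sub>R Y) Z = a * ds2 A X Z + b * ds2 A Y Z"
    by (simp add: ds2_eq_inner mmult_simps inner_add_left) (simp add: field_simps)
  show "ds2 A X Y = ds2 A Y X" by (simp add: ds2_eq_inner inner_commute)
  assume "X \<noteq> 0"
  then show "ds2 A X X > 0" by (simp add: ds2_eq_inner add_pos_nonneg)
next
  fix X Y :: "real^'n^'n \<Rightarrow> real^'n^'n"
  assume "smooth_map_on M X \<and> smooth_map_on M Y \<and>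
    (\<forall>p\<in>M. X p \<in> tangent_space M p \<and> Y p \<in> tangent_space M p)"
  then have XY: "smooth_map_on M X" "smooth_map_on M Y" by auto
  show "smooth_map_on M (\<lambda>p. ds2 p (X p) (Y p))"
    unfolding ds2_eq_inner
    by (intro smooth_map_on_add smooth_map_on_bounded_bilinear[OF bounded_bilinear_mult]
        smooth_map_on_bounded_bilinear[OF bounded_bilinear_inner]
        smooth_map_on_bounded_bilinear[OF bounded_bilinear_matrix_mult]
        smooth_map_on_const smooth_map_on_ident XY)
qed

text \<open>Applying \<open>J_tilde\<close> to both arguments interchanges the two summands of
  \<open>ds2\<close>.\<close>

lemma hermitian_metric_ds2:
  assumes "\<And>A. A \<in> M \<Longrightarrow> A ** A = - mat 1"
  shows "hermitian_metric M J_tilde ds2"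
  unfolding hermitian_metric_def
  by (simp add: riemannian_metric_ds2 ds2_eq_inner J_tilde_def mult_square_minus_one[OF assms])

section \<open>Closedness of the fundamental form\<close>

lemma inner_matrix_mult: "(A ** X) \<bullet> Y = X \<bullet> (transpose A ** (Y :: real^'n^'m))"
proof -
  have "trace (A ** (X ** transpose Y)) = trace ((X ** transpose Y) ** A)" by (rule trace_mul_sym)
  then show ?thesis
    by (simp add: inner_matrix_eq_trace matrix_transpose_mul matrix_mul_assoc)
qed

lemma fundamental_form_skew:
  assumes "A ** A = - mat 1" "transpose A = - A"
  shows "fundamental_form J_tilde ds2 A X Y = (A ** X) \<bullet> Y"
  by (simp add: fundamental_form_def J_tilde_def ds2_eq_inner mult_square_minus_one[OF assms(1)])
    (simp add: inner_matrix_mult assms(2) mmult_simps)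

text \<open>Conjugation by \<open>A\<close> changes the sign of the product of three matrices anticommuting
  with \<open>A\<close> but preserves its trace.\<close>

lemma trace_anticommuting_triple:
  fixes A :: "real^'n^'n"
  assumes A: "A ** A = - mat 1"
    and W: "W1 \<in> anticommuting A" "W2 \<in> anticommuting A" "W3 \<in> anticommuting A"
  shows "trace (W1 ** W2 ** W3) = 0"
proof -
  let ?P = "W1 ** W2 ** W3"
  have "?P ** A = W1 ** (W2 ** (W3 ** A))" by (simp add: matrix_mul_assoc)
  also have "\<dots> = - (W1 ** ((W2 ** A) ** W3))"
    using W(3) by (simp add: mmult_simps matrix_mul_assoc)
  also have "\<dots> = (W1 ** A) ** (W2 ** W3)"
    using W(2) by (simp add: mmult_simps matrix_mul_assoc)
  also have "\<dots> = - (A ** ?P)"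
    using W(1) by (simp add: mmult_simps matrix_mul_assoc)
  finally have PA: "?P ** A = - (A ** ?P)" .
  have "trace ((?P ** A) ** A) = trace (A ** (?P ** A))" by (rule trace_mul_sym)
  also have "A ** (?P ** A) = ?P" unfolding PA by (simp add: mmult_simps mult_square_minus_one[OF A])
  also have "(?P ** A) ** A = - ?P" by (simp add: mmult_simps A flip: matrix_mul_assoc)
  finally have "trace (- ?P) = trace ?P" .
  moreover have "trace (- ?P) = - trace ?P" by (simp add: trace_def sum_negf)
  ultimately show ?thesis by simp
qed

text \<open>Skewness of \<open>W3\<close> turns the inner product into minus the trace of the triple
  product. This kills the term in which the base point of the form is differentiated.\<close>

lemma inner_skew_anticommuting_triple:
  fixes A :: "real^'n^'n"
  assumes "A ** A = - mat 1"
    and "W1 \<in> anticommuting A" "W2 \<in> anticommuting A" "W3 \<in> skew_anticommuting A"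
  shows "(W1 ** W2) \<bullet> W3 = 0"
  using trace_anticommuting_triple[OF assms(1,2,3), of W3] assms(4)
  by (simp add: inner_matrix_eq_trace mmult_simps trace_def sum_negf)

text \<open>Along the curve both the square and the sum with the transpose are constant, so their
  derivatives at 0 vanish.\<close>

lemma tangent_skew_complex_structures:
  fixes \<gamma> :: "real \<Rightarrow> real^'n^'n"
  assumes T: "open T" "0 \<in> T" "\<And>t. t \<in> T \<Longrightarrow> \<gamma> t \<in> skew_complex_structures"
    and d: "(\<gamma> has_vector_derivative X) (at 0)"
  shows "X \<in> skew_anticommuting (\<gamma> 0)"
proof -
  have const: "Y = 0" if "(f has_vector_derivative Y) (at 0)" "\<And>t. t \<in> T \<Longrightarrow> f t = c"
    for f and Y c :: "real^'n^'n"
  proof -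
    have "((\<lambda>t. c) has_vector_derivative Y) (at 0)"
      by (rule has_vector_derivative_transform_within_open[OF that(1) T(1,2)]) (simp add: that(2))
    then show ?thesis using has_vector_derivative_const vector_derivative_unique_at by blast
  qed
  have "\<gamma> 0 ** X + X ** \<gamma> 0 = 0"
    by (rule const[OF bounded_bilinear.has_vector_derivative[OF bounded_bilinear_matrix_mult d d],
          of "- mat 1"]) (use T(3) in simp)
  moreover have "transpose X + X = 0"
    by (rule const[OF has_vector_derivative_add[OF
            bounded_linear.has_vector_derivative[OF bounded_linear_transpose d] d], of 0])
       (use T(3) in simp)
  ultimately show ?thesis by (simp add: eq_neg_iff_add_eq_0 add.commute)
qed

lemma closed_fundamental_form:
  "closed_2form (skew_complex_structures :: (real^'n^'n) set) (fundamental_form J_tilde ds2)"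
  unfolding closed_2form_def
proof (intro allI impI ballI)
  fix U V :: "(real^'n^'n) set" and \<Phi> \<Psi> S y u v w
  assume "slice_chart skew_complex_structures U V \<Phi> \<Psi> S"
  then have V: "open V" and \<Psi>: "smooth V \<Psi>" and S: "subspace S"
    and inv: "\<And>x. x \<in> U \<Longrightarrow> \<Psi> (\<Phi> x) = x"
    and img: "\<Phi> ` (U \<inter> skew_complex_structures) = V \<inter> S"
    unfolding slice_chart_def diffeo_def by auto
  assume y: "y \<in> V \<inter> S" and uvw: "u \<in> S" "v \<in> S" "w \<in> S"
  have mem: "\<Psi> x \<in> skew_complex_structures" if "x \<in> V \<inter> S" for x
    using that inv unfolding img[symmetric] by force
  \<comment> \<open>\<open>D\<close> holds the first derivatives of the parametrization, which is
    arbitrary and not a Cayley chart; \<open>H\<close> holds its second derivatives at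
    \<open>y\<close>.\<close>
  define D where "D a x = frechet_derivative \<Psi> (at x) a" for a x
  define H where "H b a = frechet_derivative (D b) (at y) a" for b a
  have C: "C_diff (Suc (Suc 0)) V \<Psi>" using \<Psi> by (simp only: smooth_def)
  have D: "(\<Psi> has_derivative (\<lambda>a. D a y)) (at y)"
    using C y by (auto simp: D_def frechet_derivative_works)
  have H: "(D b has_derivative H b) (at y)" for b
    using C y by (auto simp: D_def[abs_def] H_def[abs_def] frechet_derivative_works)
  have sym: "H b a = H a b" for a b
    using second_derivative_symmetric[OF V _ \<Psi>] y by (simp add: H_def D_def[abs_def])
  define P where "P = \<Psi> y"
  have P: "P ** P = - mat 1" "transpose P = - P" using mem[OF y] by (auto simp: P_def)
  \<comment> \<open>For these parameters, with \<open>a\<close> in \<open>S\<close>, the line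
    through \<open>y\<close> stays in the slice, so \<Psi> maps it to a curve of skew complex
    structures.\<close>
  define T where "T a = {t. y + t *\<^sub>R a \<in> V}" for a
  have T: "open (T a)" "0 \<in> T a" for a
  proof -
    have "open ((\<lambda>t. y + t *\<^sub>R a) -` V)" by (intro open_vimage V continuous_intros)
    then show "open (T a)" by (simp add: T_def vimage_def)
    show "0 \<in> T a" using y by (simp add: T_def)
  qed
  have line: "y + t *\<^sub>R a \<in> V \<inter> S" if "t \<in> T a" "a \<in> S" for t a
    using that y S by (auto simp: T_def subspace_add subspace_scale)
  have D0: "((\<lambda>t. \<Psi> (y + t *\<^sub>R a)) has_vector_derivative D a y) (at 0)" for a
    by (rule has_vector_derivative_along_line) (simp add: D)
  have H0: "((\<lambda>t. D b (y + t *\<^sub>R a)) has_vector_derivative H b a) (at 0)" for a b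
    by (rule has_vector_derivative_along_line) (simp add: H)
  have tan: "D a y \<in> skew_anticommuting P" if "a \<in> S" for a
    using tangent_skew_complex_structures[OF T _ D0, of a] mem line that by (simp add: P_def)
  have deriv: "deriv (\<lambda>t. pullback2 \<Psi> (fundamental_form J_tilde ds2) (y + t *\<^sub>R a) b c) 0
      = (P ** D b y) \<bullet> H c a + (P ** H b a) \<bullet> D c y"
    if abc: "a \<in> S" "b \<in> S" "c \<in> S" for a b c
  proof -
    have "((\<lambda>t. (\<Psi> (y + t *\<^sub>R a) ** D b (y + t *\<^sub>R a)) \<bullet> D c (y + t *\<^sub>R a)) has_vector_derivative
        (\<Psi> (y + 0 *\<^sub>R a) ** D b (y + 0 *\<^sub>R a)) \<bullet> H c a
        + (\<Psi> (y + 0 *\<^sub>R a) ** H b a + D a y ** D b (y + 0 *\<^sub>R a)) \<bullet> D c (y + 0 *\<^sub>R a)) (at 0)"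
      by (intro bounded_bilinear.has_vector_derivative[OF bounded_bilinear_inner]
          bounded_bilinear.has_vector_derivative[OF bounded_bilinear_matrix_mult] D0 H0)
    then have "((\<lambda>t. (\<Psi> (y + t *\<^sub>R a) ** D b (y + t *\<^sub>R a)) \<bullet> D c (y + t *\<^sub>R a))
        has_real_derivative (P ** D b y) \<bullet> H c a + (P ** H b a) \<bullet> D c y) (at 0)"
      \<comment> \<open>Of the three product rule terms, the one with all three first derivatives is
        zero.\<close>
      using inner_skew_anticommuting_triple[OF P(1), of "D a y" "D b y" "D c y"] tan[OF abc(1)]
        tan[OF abc(2)] tan[OF abc(3)]
      by (simp add: has_real_derivative_iff_has_vector_derivative inner_add_left P_def)
    \<comment> \<open>The simple formula for the form is valid at skew complex structures, which is
      why the transfer is confined to the open set \<open>T a\<close>.\<close>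
    then have "((\<lambda>t. pullback2 \<Psi> (fundamental_form J_tilde ds2) (y + t *\<^sub>R a) b c)
        has_real_derivative (P ** D b y) \<bullet> H c a + (P ** H b a) \<bullet> D c y) (at 0)"
    proof (rule has_field_derivative_transform_within_open[OF _ T])
      fix t assume "t \<in> T a"
      then have "\<Psi> (y + t *\<^sub>R a) \<in> skew_complex_structures" using mem line abc(1) by blast
      then show "(\<Psi> (y + t *\<^sub>R a) ** D b (y + t *\<^sub>R a)) \<bullet> D c (y + t *\<^sub>R a)
          = pullback2 \<Psi> (fundamental_form J_tilde ds2) (y + t *\<^sub>R a) b c"
        by (simp add: pullback2_def fundamental_form_skew D_def)
    qed
    then show ?thesis by (rule DERIV_imp_deriv)
  qed
  have skew: "(P ** X) \<bullet> Y = - ((P ** Y) \<bullet> X)" for X Y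
    by (simp only: inner_matrix_mult[of P X Y] P(2) mmult.minus_left inner_minus_right
        inner_commute[of X])
  \<comment> \<open>Six terms remain. Symmetry of \<open>H\<close> cancels the two pairs containing
    \<open>D w y\<close> and \<open>D u y\<close>; the pair containing \<open>D v y\<close> also
    requires \<open>skew\<close>.\<close>
  show "ext_deriv2 (pullback2 \<Psi> (fundamental_form J_tilde ds2)) y u v w = 0"
    unfolding ext_deriv2_def deriv[OF uvw(1,2,3)] deriv[OF uvw(2,1,3)] deriv[OF uvw(3,1,2)]
    using skew[of "H u w" "D v y"] sym[of v u] sym[of w u] sym[of w v] by simp
qed

theorem theorem2p6:
  fixes n :: nat and i0 :: "'i::finite"
  assumes "n \<ge> 1" and "CARD('i) = 2 * n + 2"
  shows "kaehler_submanifold (orth_twistor_space i0) complex_structures ds2 J_tilde"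
  \<comment> \<open>The skew description replaces the twistor space throughout; the closing
    \<open>simp\<close> supplies the square -1 for the Hermitian property.\<close>
  unfolding kaehler_submanifold_def kaehler_manifold_def orth_twistor_space_eq
  by (intro conjI complex_submanifold_skew complex_manifold_skew hermitian_metric_ds2
      closed_fundamental_form) simp

end
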